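(* Let $U$ be an optimal machine. Then: (a) $\underline{E}(A)>0$ for every algorithm $A$; (b) there exists $\varepsilon>0$ such that $\overline{E}(A)\ge \varepsilon$ for every algorithm $A$; (c) for every $\varepsilon>0$ there exists an algorithm $A$ such that $\underline{E}(A)\le\varepsilon$; (d) if we consider only algorithms that may be undefined but never produce wrong answers, then the statement ``for every $\varepsilon>0$ there exists an algorithm $A$ of this type such that $\underline{E}(A)\le\varepsilon$'' may be true or false depending on the choice of $U$; for example, it always holds when $U$ is left-total and never holds when $U$ is effectively optimal.
   Context: A machine is a partial computable function from binary strings to binary strings. For a machine $V$ let $C_V(x)=\min\{|p|\colon V(p)=x\}$. A machine $U$ is optimal if for every machine $V$ there is $c$ with $C_U(x)\le C_V(x)+c$ for all $x$. A machine $U$ is effectively optimal if for every machine $V$ there is a total computable function $h$ with $|h(x)|\le|x|+c$ for some $c$ and all $x$, such that $V(x)=U(h(x))$ for all $x$ (both undefined or both defined and equal). A machine is left-total if for every $n$ the $n$-bit strings in its domain form an initial segment in the lexicographic ordering. An algorithm $A$ is a partial computable function, viewed as an attempt to decide $\mathrm{dom}(U)$; $A$ errs on $x$ if $x\in\mathrm{dom}(U)$ and $A(x)$ does not output $1$, or $x\notin\mathrm{dom}(U)$ and $A(x)$ does not output $0$. $\varepsilon_n(A)$ is the fraction of such error strings among all strings of length at most $n$; $\overline{E}(A)=\limsup_n\varepsilon_n(A)$ and $\underline{E}(A)=\liminf_n\varepsilon_n(A)$. *)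

theory Defs
  imports Complex_Main "HOL-Library.Extended_Real" "HOL-Library.Extended_Nat"
begin

type_synonym bstr = "bool list"

text \<open>Bijective base-2 numbering of binary strings (False = 0, True = 1).\<close>
fun str_to_nat :: "bstr \<Rightarrow> nat" where
  "str_to_nat [] = 0"
| "str_to_nat (b # xs) = 2 * str_to_nat xs + (if b then 2 else 1)"

definition nat_to_str :: "nat \<Rightarrow> bstr" where
  "nat_to_str n = (THE x. str_to_nat x = n)"

datatype recf = Zero | Succ | Proj nat | Comp recf "recf list" | Prim recf recf | Mu recf

inductive rec_eval :: "recf \<Rightarrow> nat list \<Rightarrow> nat \<Rightarrow> bool"
  and rec_evals :: "recf list \<Rightarrow> nat list \<Rightarrow> nat list \<Rightarrow> bool" where
  ev_zero: "rec_eval Zero xs 0"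
| ev_succ: "rec_eval Succ (x # xs) (Suc x)"
| ev_proj: "i < length xs \<Longrightarrow> rec_eval (Proj i) xs (xs ! i)"
| ev_comp: "rec_evals gs xs ys \<Longrightarrow> rec_eval f ys y \<Longrightarrow> rec_eval (Comp f gs) xs y"
| evs_nil: "rec_evals [] xs []"
| evs_cons: "rec_eval g xs y \<Longrightarrow> rec_evals gs xs ys \<Longrightarrow> rec_evals (g # gs) xs (y # ys)"
| ev_prim0: "rec_eval f xs y \<Longrightarrow> rec_eval (Prim f g) (0 # xs) y"
| ev_primS: "rec_eval (Prim f g) (n # xs) z \<Longrightarrow> rec_eval g (z # n # xs) y
             \<Longrightarrow> rec_eval (Prim f g) (Suc n # xs) y"
| ev_mu: "rec_eval f (n # xs) 0 \<Longrightarrow> (\<forall>m<n. \<exists>k. rec_eval f (m # xs) (Suc k))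
          \<Longrightarrow> rec_eval (Mu f) xs n"

definition computable :: "(bstr \<Rightarrow> bstr option) \<Rightarrow> bool" where
  "computable f \<longleftrightarrow> (\<exists>r. \<forall>x y. rec_eval r [str_to_nat x] y \<longleftrightarrow> f x = Some (nat_to_str y))"

text \<open>Machines and algorithms are both partial computable functions on strings (predicate computable).\<close>

definition C :: "(bstr \<Rightarrow> bstr option) \<Rightarrow> bstr \<Rightarrow> enat" where
  "C V x = (if \<exists>p. V p = Some x
            then enat (LEAST n. \<exists>p. length p = n \<and> V p = Some x) else \<infinity>)"

definition optimal :: "(bstr \<Rightarrow> bstr option) \<Rightarrow> bool" where
  "optimal U \<longleftrightarrow> (\<forall>V. computable V \<longrightarrow> (\<exists>c::nat. \<forall>x. C U x \<le> C V x + enat c))"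

definition effectively_optimal :: "(bstr \<Rightarrow> bstr option) \<Rightarrow> bool" where
  "effectively_optimal U \<longleftrightarrow> (\<forall>V. computable V \<longrightarrow>
     (\<exists>h c. computable (\<lambda>x. Some (h x)) \<and> (\<forall>x. length (h x) \<le> length x + c)
            \<and> (\<forall>x. V x = U (h x))))"

definition lex_le :: "bstr \<Rightarrow> bstr \<Rightarrow> bool" where
  "lex_le y x \<longleftrightarrow> y = x \<or> (y, x) \<in> lexord {(a, b). a < b}"

definition left_total :: "(bstr \<Rightarrow> bstr option) \<Rightarrow> bool" where
  "left_total U \<longleftrightarrow> (\<forall>n x y. length x = n \<and> length y = n \<and> lex_le y x \<and> x \<in> dom U
                        \<longrightarrow> y \<in> dom U)"

text \<open>Output 1 is the string [True], output 0 is the string [False].\<close>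
definition errs :: "(bstr \<Rightarrow> bstr option) \<Rightarrow> (bstr \<Rightarrow> bstr option) \<Rightarrow> bstr \<Rightarrow> bool" where
  "errs U A x \<longleftrightarrow> (x \<in> dom U \<and> A x \<noteq> Some [True]) \<or> (x \<notin> dom U \<and> A x \<noteq> Some [False])"

definition err_frac :: "(bstr \<Rightarrow> bstr option) \<Rightarrow> (bstr \<Rightarrow> bstr option) \<Rightarrow> nat \<Rightarrow> real" where
  "err_frac U A n = real (card {x. length x \<le> n \<and> errs U A x}) / real (card {x::bstr. length x \<le> n})"

definition E_upper :: "(bstr \<Rightarrow> bstr option) \<Rightarrow> (bstr \<Rightarrow> bstr option) \<Rightarrow> ereal" where
  "E_upper U A = limsup (\<lambda>n. ereal (err_frac U A n))"

definition E_lower :: "(bstr \<Rightarrow> bstr option) \<Rightarrow> (bstr \<Rightarrow> bstr option) \<Rightarrow> ereal" where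
  "E_lower U A = liminf (\<lambda>n. ereal (err_frac U A n))"

definition never_wrong :: "(bstr \<Rightarrow> bstr option) \<Rightarrow> (bstr \<Rightarrow> bstr option) \<Rightarrow> bool" where
  "never_wrong U A \<longleftrightarrow> (\<forall>x. A x = None \<or> (A x = Some [True] \<and> x \<in> dom U)
                                     \<or> (A x = Some [False] \<and> x \<notin> dom U))"

definition approx_never_wrong :: "(bstr \<Rightarrow> bstr option) \<Rightarrow> bool" where
  "approx_never_wrong U \<longleftrightarrow>
     (\<forall>\<epsilon>>0. \<exists>A. computable A \<and> never_wrong U A \<and> E_lower U A \<le> ereal \<epsilon>)"

end

theory Submission
  imports Defs "HOL-Library.Nat_Bijection"
begin

text \<open>Parts (a) and (b): an algorithm that errs rarely on the strings of length at most \<open>n\<close> reveals,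
  up to a small error, how many of them are in the domain.  Waiting until about that many have
  halted, one knows nearly all strings of complexity at most \<open>n\<close>, and can name a string outside
  this set with fewer than \<open>n\<close> bits.  For (b) the algorithm itself is encoded in \<open>n\<close>, so that the
  error bound does not depend on it.

  Part (c): some approximate density of the domain occurs for infinitely many \<open>n\<close>; wait until that
  many strings have halted, and declare the other ones non-halting.  If the machine is left-total
  and the density is the largest one that occurs infinitely often, then only few strings are still
  to halt, and those are the first among the remaining ones, so a negative answer is safe for all
  others.  Any optimal machine becomes left-total by listing its outputs in order of appearance.

  For an effectively optimal machine, a program that knows its own translation \<open>h\<close> can refute all
  wrong algorithms by diagonalization at negligible cost, and enforces that \<open>h\<close> is injective.  Hence
  a never-wrong algorithm is undefined on most values of \<open>h\<close>, which have positive density.\<close>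

section \<open>Total recursive functions\<close>

text \<open>Two obstacles shape the constructions.

  An algorithm sees the length of its input, but not the \<open>n\<close> up to which errors are
  counted. For the upper bounds, lengths are therefore grouped into blocks: all inputs of a block
  look at the same finite set, the strings up to the end of the block, and shorter strings are too
  few to matter there. A built-in density that is right for infinitely many blocks then controls the
  lower limit. Where the true density exceeds the built-in one, many strings called non-halting
  still halt; part (c) tolerates this, whereas an algorithm that is never wrong must avoid it, hence
  the largest recurring density.

  Optimality yields its constant \<open>c\<close>, or its translation \<open>h\<close>, only after a
  machine has been fixed, while the machine ought to know it. So the machine reads a parameter from
  a unary prefix of its input, acts correctly for every value of it, and the right value is chosen
  afterwards. The prefix costs a constant number of bits.

  Programs are never written out: a partial function is given by a decidable relation between input,
  output and witness.\<close>

inductive_cases rec_eval_elims: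
  "rec_eval Zero xs y" "rec_eval Succ xs y" "rec_eval (Proj i) xs y" "rec_eval (Comp f gs) xs y"
  "rec_eval (Prim f g) xs y" "rec_eval (Mu f) xs y"
  "rec_evals [] xs ys" "rec_evals (g # gs) xs ys"

lemma rec_eval_det:
  "rec_eval r xs y \<Longrightarrow> rec_eval r xs y' \<Longrightarrow> y = y'"
  "rec_evals rs xs ys \<Longrightarrow> rec_evals rs xs ys' \<Longrightarrow> ys = ys'"
proof (induction arbitrary: y' and ys' rule: rec_eval_rec_evals.inducts)
  case (ev_mu f n xs)
  from ev_mu.prems show ?case
  proof (rule rec_eval_elims(6))
    assume *: "rec_eval f (y' # xs) 0" "\<forall>m<y'. \<exists>k. rec_eval f (m # xs) (Suc k)"
    show "n = y'"
    proof (rule linorder_cases[of n y'])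
      assume "n < y'"
      then obtain k where "rec_eval f (n # xs) (Suc k)"
        using * by blast
      with ev_mu.IH(1) show ?thesis by fastforce
    next
      assume "y' < n"
      with ev_mu.IH(2) *(1) show ?thesis by fastforce
    qed
  qed
next
  case (ev_zero xs) then show ?case by (auto elim: rec_eval_elims(1))
next
  case (ev_succ x xs) then show ?case by (auto elim: rec_eval_elims(2))
next
  case (ev_proj i xs) then show ?case by (auto elim: rec_eval_elims(3))
next
  case (ev_comp gs xs ys f y)
  from ev_comp.prems ev_comp.IH show ?case by (elim rec_eval_elims(4)) blast
next
  case (evs_nil xs) then show ?case by (auto elim: rec_eval_elims(7))
next
  case (evs_cons g xs y gs ys)
  from evs_cons.prems evs_cons.IH show ?case by (elim rec_eval_elims(8)) blast
next
  case (ev_prim0 f xs y g)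
  from ev_prim0.prems have "rec_eval f xs y'" by (rule rec_eval_elims(5)) simp_all
  with ev_prim0.IH show ?case by blast
next
  case (ev_primS f g n xs z y)
  from ev_primS.prems obtain z' where "rec_eval (Prim f g) (n # xs) z'" "rec_eval g (z' # n # xs) y'"
    by (rule rec_eval_elims(5)) simp_all
  with ev_primS.IH show ?case by blast
qed

definition recfn :: "nat \<Rightarrow> (nat list \<Rightarrow> nat) \<Rightarrow> bool" where
  "recfn k f \<longleftrightarrow> (\<exists>r. \<forall>xs. length xs = k \<longrightarrow> rec_eval r xs (f xs))"

lemma recfn_cong: "recfn k f \<Longrightarrow> (\<And>xs. length xs = k \<Longrightarrow> f xs = g xs) \<Longrightarrow> recfn k g"
  unfolding recfn_def by (elim exE, intro exI) simp

lemma recfn_proj: "i < k \<Longrightarrow> recfn k (\<lambda>xs. xs ! i)"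
  unfolding recfn_def by (metis ev_proj)

lemma recfn_Suc: "recfn k f \<Longrightarrow> recfn k (\<lambda>xs. Suc (f xs))"
  unfolding recfn_def by (metis ev_comp ev_succ evs_cons evs_nil)

lemma recfn_const: "recfn k (\<lambda>xs. c)"
proof (induction c)
  case 0
  then show ?case unfolding recfn_def by (metis ev_zero)
qed (rule recfn_Suc)

lemma recfn_comp:
  assumes f: "recfn (length gs) f" and gs: "\<And>g. g \<in> set gs \<Longrightarrow> recfn k g"
  shows "recfn k (\<lambda>xs. f (map (\<lambda>g. g xs) gs))"
proof -
  have "\<exists>rs. \<forall>xs. length xs = k \<longrightarrow> rec_evals rs xs (map (\<lambda>g. g xs) gs)"
    using gs
  proof (induction gs)
    case Nil
    show ?case using evs_nil by auto
  next
    case (Cons g gs)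
    then obtain rs where rs: "\<And>xs. length xs = k \<Longrightarrow> rec_evals rs xs (map (\<lambda>g. g xs) gs)"
      by auto
    from Cons.prems[of g] obtain r where r: "\<And>xs. length xs = k \<Longrightarrow> rec_eval r xs (g xs)"
      unfolding recfn_def by auto
    show ?case using evs_cons[OF r rs] by auto
  qed
  then obtain rs where rs: "\<And>xs. length xs = k \<Longrightarrow> rec_evals rs xs (map (\<lambda>g. g xs) gs)"
    by blast
  obtain r where "\<And>xs. length xs = length gs \<Longrightarrow> rec_eval r xs (f xs)"
    using f unfolding recfn_def by blast
  with rs show ?thesis
    unfolding recfn_def by (metis ev_comp length_map)
qed

lemma recfn_comp1: "recfn 1 f \<Longrightarrow> recfn k a \<Longrightarrow> recfn k (\<lambda>xs. f [a xs])"
  using recfn_comp[of "[a]" f k] by simp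

lemma rec_evals_projs: "rec_evals (map Proj [0..<length xs]) xs xs"
proof -
  have "rec_evals (map Proj is) xs (map (\<lambda>i. xs ! i) is)" if "\<forall>i\<in>set is. i < length xs" for "is"
    using that by (induction "is") (auto intro: rec_eval_rec_evals.intros)
  from this[of "[0..<length xs]"] show ?thesis by (simp add: map_nth)
qed

lemma recfn_rec_nat:
  assumes "recfn k a" "recfn k b" "recfn (Suc (Suc k)) g"
  shows "recfn k (\<lambda>xs. rec_nat (a xs) (\<lambda>n z. g (z # n # xs)) (b xs))"
proof -
  obtain A B G where A: "\<And>xs. length xs = k \<Longrightarrow> rec_eval A xs (a xs)"
    and B: "\<And>xs. length xs = k \<Longrightarrow> rec_eval B xs (b xs)"
    and G: "\<And>xs. length xs = Suc (Suc k) \<Longrightarrow> rec_eval G xs (g xs)"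
    using assms unfolding recfn_def by blast
  have P: "rec_eval (Prim A G) (m # xs) (rec_nat (a xs) (\<lambda>n z. g (z # n # xs)) m)"
    if "length xs = k" for xs m
    using that by (induction m) (auto intro!: ev_prim0 ev_primS A G)
  have "rec_eval (Comp (Prim A G) (B # map Proj [0..<k])) xs (rec_nat (a xs) (\<lambda>n z. g (z # n # xs)) (b xs))"
    if "length xs = k" for xs
    using rec_evals_projs[of xs] B[OF that] P[OF that] that by (auto intro!: ev_comp evs_cons)
  then show ?thesis unfolding recfn_def by blast
qed

lemma recfn_Least:
  assumes "recfn (Suc k) f" "\<And>xs. length xs = k \<Longrightarrow> \<exists>n. f (n # xs) = 0"
  shows "recfn k (\<lambda>xs. LEAST n. f (n # xs) = 0)"
proof -
  obtain F where F: "\<And>xs. length xs = Suc k \<Longrightarrow> rec_eval F xs (f xs)"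
    using assms unfolding recfn_def by blast
  have "rec_eval (Mu F) xs (LEAST n. f (n # xs) = 0)" if "length xs = k" for xs
  proof (rule ev_mu)
    show "rec_eval F ((LEAST n. f (n # xs) = 0) # xs) 0"
      using F[of "(LEAST n. f (n # xs) = 0) # xs"] LeastI_ex[OF assms(2)[OF that]] that by simp
    show "\<forall>m<(LEAST n. f (n # xs) = 0). \<exists>k. rec_eval F (m # xs) (Suc k)"
    proof (intro allI impI)
      fix m assume "m < (LEAST n. f (n # xs) = 0)"
      then have "f (m # xs) \<noteq> 0" using not_less_Least by blast
      then show "\<exists>k. rec_eval F (m # xs) (Suc k)"
        using F[of "m # xs"] that by (metis length_Cons not0_implies_Suc)
    qed
  qed
  then show ?thesis unfolding recfn_def by blast
qed

section \<open>Arithmetic and the Cantor pairing function\<close>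

lemma recfn_add:
  assumes "recfn k a" "recfn k b" shows "recfn k (\<lambda>xs. a xs + b xs)"
proof (rule recfn_cong)
  show "recfn k (\<lambda>xs. rec_nat (a xs) (\<lambda>n z. Suc ((z # n # xs) ! 0)) (b xs))"
    by (intro recfn_rec_nat recfn_Suc recfn_proj assms) simp
  have "rec_nat i (\<lambda>n z. Suc ((z # n # xs) ! 0)) j = i + j" for i j and xs :: "nat list"
    by (induction j) auto
  then show "rec_nat (a xs) (\<lambda>n z. Suc ((z # n # xs) ! 0)) (b xs) = a xs + b xs" for xs .
qed

lemma recfn_diff:
  assumes "recfn k a" "recfn k b" shows "recfn k (\<lambda>xs. a xs - b xs)"
proof -
  have pred: "recfn 1 (\<lambda>xs. xs ! 0 - 1)"
  proof (rule recfn_cong)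
    show "recfn 1 (\<lambda>xs. rec_nat 0 (\<lambda>n z. (z # n # xs) ! 1) (xs ! 0))"
      by (intro recfn_rec_nat recfn_proj recfn_const) simp_all
    show "rec_nat 0 (\<lambda>n z. (z # n # xs) ! 1) (xs ! 0) = xs ! 0 - 1" for xs
      by (cases "xs ! 0") auto
  qed
  show ?thesis
  proof (rule recfn_cong)
    show "recfn k (\<lambda>xs. rec_nat (a xs) (\<lambda>n z. [(z # n # xs) ! 0] ! 0 - 1) (b xs))"
      by (rule recfn_rec_nat[OF assms recfn_comp1[OF pred recfn_proj]]) simp
    have "rec_nat i (\<lambda>n z. [(z # n # xs) ! 0] ! 0 - 1) j = i - j" for i j and xs :: "nat list"
      by (induction j) auto
    then show "rec_nat (a xs) (\<lambda>n z. [(z # n # xs) ! 0] ! 0 - 1) (b xs) = a xs - b xs" for xs .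
  qed
qed

lemma recfn_triangle:
  assumes "recfn k a" shows "recfn k (\<lambda>xs. triangle (a xs))"
proof (rule recfn_cong)
  show "recfn k (\<lambda>xs. rec_nat 0 (\<lambda>n z. (z # n # xs) ! 0 + Suc ((z # n # xs) ! 1)) (a xs))"
    by (intro recfn_rec_nat recfn_add recfn_Suc recfn_proj recfn_const assms) auto
  have "rec_nat 0 (\<lambda>n z. (z # n # xs) ! 0 + Suc ((z # n # xs) ! 1)) j = triangle j" for xs :: "nat list" and j
    by (induction j) auto
  then show "rec_nat 0 (\<lambda>n z. (z # n # xs) ! 0 + Suc ((z # n # xs) ! 1)) (a xs) = triangle (a xs)" for xs .
qed

lemma recfn_prod_encode:
  assumes "recfn k a" "recfn k b" shows "recfn k (\<lambda>xs. prod_encode (a xs, b xs))"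
  unfolding prod_encode_def prod.case by (intro recfn_add recfn_triangle assms)

abbreviation "pfst n \<equiv> fst (prod_decode n)"
abbreviation "psnd n \<equiv> snd (prod_decode n)"

text \<open>The Cantor code of \<open>(a, b)\<close> lies between \<open>triangle (a + b)\<close>
  and \<open>triangle (a + b + 1)\<close>, so a search recovers the diagonal \<open>a + b\<close>,
  and from it both components. Truncated subtraction turns the strict inequality into an equation
  with 0, the form that \<open>recfn_Least\<close> searches for.\<close>

lemma Least_triangle: "(LEAST n. Suc (prod_encode (a, b)) - triangle (Suc n) = 0) = a + b"
proof (rule Least_equality)
  fix n assume n: "Suc (prod_encode (a, b)) - triangle (Suc n) = 0"
  show "a + b \<le> n"
  proof (rule ccontr)
    assume "\<not> a + b \<le> n"
    then have "Suc n \<le> a + b" by simp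
    moreover have "mono triangle" by (simp add: mono_iff_le_Suc)
    ultimately have "triangle (Suc n) \<le> triangle (a + b)" by (rule monoD[rotated])
    then show False using n by (simp add: prod_encode_def)
  qed
qed (simp add: prod_encode_def)

lemma recfn_psum:
  assumes "recfn k a" shows "recfn k (\<lambda>xs. pfst (a xs) + psnd (a xs))"
proof -
  have *: "recfn 1 (\<lambda>xs. pfst (xs ! 0) + psnd (xs ! 0))"
  proof (rule recfn_cong)
    show "recfn 1 (\<lambda>xs. LEAST n. Suc ((n # xs) ! 1) - triangle (Suc ((n # xs) ! 0)) = 0)"
    proof (rule recfn_Least)
      show "recfn (Suc 1) (\<lambda>xs. Suc (xs ! 1) - triangle (Suc (xs ! 0)))"
        by (intro recfn_diff recfn_triangle recfn_Suc recfn_proj) auto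
      have "n \<le> triangle n" for n by (induction n) auto
      then show "\<exists>n. Suc ((n # xs) ! 1) - triangle (Suc ((n # xs) ! 0)) = 0" for xs
        by (intro exI[of _ "xs ! 0"]) auto
    qed
    show "(LEAST n. Suc ((n # xs) ! 1) - triangle (Suc ((n # xs) ! 0)) = 0) = pfst (xs ! 0) + psnd (xs ! 0)" for xs
      using Least_triangle[of "pfst (xs ! 0)" "psnd (xs ! 0)"] by simp
  qed
  from recfn_comp1[OF * assms] show ?thesis by simp
qed

lemma recfn_pfst:
  assumes "recfn k a" shows "recfn k (\<lambda>xs. pfst (a xs))"
proof (rule recfn_cong)
  show "recfn k (\<lambda>xs. a xs - triangle (pfst (a xs) + psnd (a xs)))"
    by (intro recfn_diff recfn_triangle recfn_psum assms)
  have "prod_encode (i, j) - triangle (i + j) = i" for i j by (simp add: prod_encode_def)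
  from this[of "pfst (a xs)" "psnd (a xs)" for xs]
  show "a xs - triangle (pfst (a xs) + psnd (a xs)) = pfst (a xs)" for xs by simp
qed

lemma recfn_psnd:
  assumes "recfn k a" shows "recfn k (\<lambda>xs. psnd (a xs))"
proof (rule recfn_cong)
  show "recfn k (\<lambda>xs. (pfst (a xs) + psnd (a xs)) - pfst (a xs))"
    by (intro recfn_diff recfn_psum recfn_pfst assms)
qed simp

section \<open>Total computable functions between coded types\<close>

text \<open>Codes are bijective so that \<open>dec\<close> is a two-sided inverse: every number is a
  valid code, and a search through the numbers is a search through the type.\<close>

class enc =
  fixes enc :: "'a \<Rightarrow> nat"
  assumes bij_enc: "bij enc"

definition dec :: "nat \<Rightarrow> 'a::enc" where "dec = inv enc"

lemma dec_enc [simp]: "dec (enc x) = x"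
  unfolding dec_def by (simp add: bij_enc bij_is_inj)

lemma enc_dec [simp]: "enc (dec n) = n"
  unfolding dec_def by (simp add: bij_enc bij_is_surj surj_f_inv_f)

lemma enc_eq_iff [simp]: "enc x = enc y \<longleftrightarrow> x = y"
  by (metis dec_enc)

instantiation nat :: enc
begin
definition enc_nat :: "nat \<Rightarrow> nat" where "enc_nat n = n"
instance by standard (simp add: enc_nat_def[abs_def] bij_def)
end

lemma enc_nat_simp [simp]: "enc (n::nat) = n"
  by (simp add: enc_nat_def)

lemma dec_nat_simp [simp]: "dec n = (n::nat)"
  by (metis dec_enc enc_nat_simp)

instantiation prod :: (enc, enc) enc
begin
definition enc_prod :: "'a \<times> 'b \<Rightarrow> nat" where "enc_prod p = prod_encode (map_prod enc enc p)"
instance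
proof
  have "bij (map_prod enc enc :: 'a \<times> 'b \<Rightarrow> nat \<times> nat)"
    using bij_betw_map_prod[OF bij_enc bij_enc] by simp
  from bij_comp[OF this bij_prod_encode]
  show "bij (enc :: 'a \<times> 'b \<Rightarrow> nat)" by (simp add: enc_prod_def[abs_def] o_def)
qed
end

lemma enc_Pair [simp]: "enc (a, b) = prod_encode (enc a, enc b)"
  by (simp add: enc_prod_def)

lemma enc_fst: "enc (fst p) = pfst (enc p)"
  by (simp add: enc_prod_def)

lemma enc_snd: "enc (snd p) = psnd (enc p)"
  by (simp add: enc_prod_def)

instantiation list :: (enc) enc
begin
definition enc_list :: "'a list \<Rightarrow> nat" where "enc_list xs = list_encode (map enc xs)"
instance
proof
  have "bij (map enc :: 'a list \<Rightarrow> nat list)"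
    by (rule o_bij[of "map dec"]) (simp_all add: o_def fun_eq_iff)
  from bij_comp[OF this bij_list_encode]
  show "bij (enc :: 'a list \<Rightarrow> nat)" by (simp add: enc_list_def[abs_def] o_def)
qed
end

lemma enc_Nil [simp]: "enc [] = 0"
  by (simp add: enc_list_def)

lemma enc_Cons [simp]: "enc (x # xs) = Suc (prod_encode (enc x, enc xs))"
  by (simp add: enc_list_def)

definition trec :: "(nat \<Rightarrow> nat) \<Rightarrow> bool" where
  "trec g \<longleftrightarrow> recfn 1 (\<lambda>xs. g (hd xs))"

lemma trec_iff: "trec g \<longleftrightarrow> (\<exists>r. \<forall>x. rec_eval r [x] (g x))"
proof
  assume "trec g"
  then obtain r where "\<forall>xs. length xs = 1 \<longrightarrow> rec_eval r xs (g (hd xs))"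
    unfolding trec_def recfn_def by blast
  then have "rec_eval r [x] (g x)" for x by (metis One_nat_def length_Cons list.sel(1) list.size(3))
  then show "\<exists>r. \<forall>x. rec_eval r [x] (g x)" by blast
next
  assume "\<exists>r. \<forall>x. rec_eval r [x] (g x)"
  then obtain r where "\<And>x. rec_eval r [x] (g x)" by blast
  then have "length xs = 1 \<longrightarrow> rec_eval r xs (g (hd xs))" for xs by (cases xs) auto
  then show "trec g" unfolding trec_def recfn_def by blast
qed

lemma trec_recfn: 
  assumes "trec g" "recfn k a" shows "recfn k (\<lambda>xs. g (a xs))"
  using recfn_comp1[OF assms(1)[unfolded trec_def] assms(2)] by simp

text \<open>Closure rules for this predicate and for \<open>decid\<close> are collected in
  \<open>tc\<close>, so \<open>intro tc\<close> verifies computability by following the syntax of a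
  function. Variables bound inside it travel as components of a tuple.\<close>

definition tcomp :: "('a::enc \<Rightarrow> 'b::enc) \<Rightarrow> bool" where
  "tcomp f \<longleftrightarrow> trec (\<lambda>n. enc (f (dec n)))"

definition decid :: "('a::enc \<Rightarrow> bool) \<Rightarrow> bool" where
  "decid P \<longleftrightarrow> tcomp (\<lambda>z. if P z then 1 else 0 :: nat)"

named_theorems tc

lemma recfn_hd: "recfn 1 hd"
  by (rule recfn_cong[OF recfn_proj[of 0 1]]) (simp, metis hd_conv_nth length_greater_0_conv zero_less_one)

lemma tcomp_id [tc]: "tcomp (\<lambda>z. z)"
  unfolding tcomp_def trec_def using recfn_hd by simp

lemma tcomp_const [tc]: "tcomp (\<lambda>z. c)"
  unfolding tcomp_def trec_def by (rule recfn_const)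

lemma tcomp_comp: "tcomp f \<Longrightarrow> tcomp g \<Longrightarrow> tcomp (\<lambda>z. f (g z))"
  using trec_recfn[of "\<lambda>n. enc (f (dec n))" 1 "\<lambda>xs. enc (g (dec (hd xs)))"]
  unfolding tcomp_def by (simp add: trec_def)

lemma tcomp_fst [tc]: "tcomp f \<Longrightarrow> tcomp (\<lambda>z. fst (f z))"
  unfolding tcomp_def trec_def enc_fst by (rule recfn_pfst)

lemma tcomp_snd [tc]: "tcomp f \<Longrightarrow> tcomp (\<lambda>z. snd (f z))"
  unfolding tcomp_def trec_def enc_snd by (rule recfn_psnd)

lemma tcomp_Pair [tc]: "tcomp f \<Longrightarrow> tcomp g \<Longrightarrow> tcomp (\<lambda>z. (f z, g z))"
  unfolding tcomp_def trec_def enc_Pair by (rule recfn_prod_encode)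

lemma tcomp_dec [tc]: "tcomp f \<Longrightarrow> tcomp (\<lambda>z. dec (f z))"
  unfolding tcomp_def by simp

lemma tcomp_enc [tc]: "tcomp f \<Longrightarrow> tcomp (\<lambda>z. enc (f z))"
  unfolding tcomp_def by simp

lemma tcomp_Suc [tc]: "tcomp f \<Longrightarrow> tcomp (\<lambda>z. Suc (f z))"
  unfolding tcomp_def trec_def enc_nat_simp by (rule recfn_Suc)

lemma tcomp_add [tc]: "tcomp f \<Longrightarrow> tcomp g \<Longrightarrow> tcomp (\<lambda>z. f z + g z :: nat)"
  unfolding tcomp_def trec_def enc_nat_simp by (rule recfn_add)

lemma tcomp_diff [tc]: "tcomp f \<Longrightarrow> tcomp g \<Longrightarrow> tcomp (\<lambda>z. f z - g z :: nat)"
  unfolding tcomp_def trec_def enc_nat_simp by (rule recfn_diff)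

lemma tcomp_rec_nat [tc]:
  fixes g :: "'a::enc \<Rightarrow> nat \<Rightarrow> 'b::enc \<Rightarrow> 'b"
  assumes a: "tcomp a" and b: "tcomp b" and g: "tcomp (\<lambda>w. g (fst w) (fst (snd w)) (snd (snd w)))"
  shows "tcomp (\<lambda>z. rec_nat (a z) (g z) (b z))"
proof -
  define G where "G n = enc ((\<lambda>w. g (fst w) (fst (snd w)) (snd (snd w))) (dec n))" for n
  have G_enc: "G (prod_encode (enc z, prod_encode (m, enc r))) = enc (g z m r)" for z m r
  proof -
    have "dec (prod_encode (enc z, prod_encode (m, enc r))) = (z, m, r)"
      using dec_enc[of "(z, m, r)"] by (simp only: enc_Pair enc_nat_simp)
    then show ?thesis by (simp add: G_def)
  qed
  have rec: "rec_nat (enc (a z)) (\<lambda>n r. G (prod_encode (enc z, prod_encode (n, r)))) m =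
    enc (rec_nat (a z) (g z) m)" for z m
    by (induction m) (simp_all add: G_enc)
  have "trec G" using g unfolding tcomp_def G_def .
  then have "recfn (Suc (Suc 1)) (\<lambda>xs. G (prod_encode (xs ! 2, prod_encode (xs ! 1, xs ! 0))))"
    by (rule trec_recfn) (intro recfn_prod_encode recfn_proj; simp)
  from recfn_rec_nat[OF a[unfolded tcomp_def trec_def] b[unfolded tcomp_def trec_def] this]
  have "recfn 1 (\<lambda>xs. rec_nat (enc (a (dec (hd xs)))) (\<lambda>n r. G (prod_encode (xs ! 0, prod_encode (n, r)))) (b (dec (hd xs))))"
    by simp
  then have "recfn 1 (\<lambda>xs. enc (rec_nat (a (dec (hd xs))) (g (dec (hd xs))) (b (dec (hd xs)))))"
  proof (rule recfn_cong)
    fix xs :: "nat list" assume "length xs = 1"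
    then have "xs ! 0 = enc (dec (hd xs) :: 'a)" by (cases xs) auto
    with rec[of "dec (hd xs)" "b (dec (hd xs))"]
    show "rec_nat (enc (a (dec (hd xs)))) (\<lambda>n r. G (prod_encode (xs ! 0, prod_encode (n, r)))) (b (dec (hd xs)))
       = enc (rec_nat (a (dec (hd xs))) (g (dec (hd xs))) (b (dec (hd xs))))" by simp
  qed
  then show ?thesis unfolding tcomp_def trec_def .
qed

lemma tcomp_mult [tc]:
  assumes "tcomp f" "tcomp g" shows "tcomp (\<lambda>z. f z * g z :: nat)"
proof -
  have "tcomp (\<lambda>z. rec_nat 0 (\<lambda>n r. r + f z) (g z))"
    by (intro tc assms tcomp_comp[OF assms(1)])
  moreover have "rec_nat 0 (\<lambda>n r. r + a) b = a * b" for a b :: nat by (induction b) auto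
  ultimately show ?thesis by simp
qed

lemma tcomp_power [tc]:
  assumes "tcomp f" "tcomp g" shows "tcomp (\<lambda>z. f z ^ g z :: nat)"
proof -
  have "tcomp (\<lambda>z. rec_nat 1 (\<lambda>n r. r * f z) (g z))"
    by (intro tc assms tcomp_comp[OF assms(1)])
  moreover have "rec_nat 1 (\<lambda>n r. r * a) b = a ^ b" for a b :: nat by (induction b) auto
  ultimately show ?thesis by simp
qed

lemma decid_comp: "decid P \<Longrightarrow> tcomp g \<Longrightarrow> decid (\<lambda>z. P (g z))"
  unfolding decid_def by (rule tcomp_comp)

lemma tcomp_If [tc]:
  assumes "decid P" "tcomp f" "tcomp g" shows "tcomp (\<lambda>z. if P z then f z else g z)"
proof -
  have "tcomp (\<lambda>z. rec_nat (g z) (\<lambda>n r. f z) (if P z then 1 else 0))"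
    by (intro tc assms assms(1)[unfolded decid_def] tcomp_comp[OF assms(2)])
  then show ?thesis by (rule back_subst[where P = tcomp]) auto
qed

lemma decid_const [tc]: "decid (\<lambda>z. b)"
  unfolding decid_def by (rule tcomp_const)

lemma decid_if_bool: "decid P \<Longrightarrow> decid Q \<Longrightarrow> decid R \<Longrightarrow> decid (\<lambda>z. if P z then Q z else R z)"
  unfolding decid_def[of Q] decid_def[of R] decid_def[of "\<lambda>z. if P z then Q z else R z"]
  by (drule (2) tcomp_If) (erule back_subst[where P = tcomp], auto)

lemma decid_not [tc]: "decid P \<Longrightarrow> decid (\<lambda>z. \<not> P z)"
  by (rule back_subst[where P = decid, OF decid_if_bool[of P "\<lambda>z. False" "\<lambda>z. True"]]) (auto simp: decid_const)

lemma decid_conj [tc]: "decid P \<Longrightarrow> decid Q \<Longrightarrow> decid (\<lambda>z. P z \<and> Q z)"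
  by (rule back_subst[where P = decid, OF decid_if_bool[of P Q "\<lambda>z. False"]]) (auto simp: decid_const)

lemma decid_disj [tc]: "decid P \<Longrightarrow> decid Q \<Longrightarrow> decid (\<lambda>z. P z \<or> Q z)"
  by (rule back_subst[where P = decid, OF decid_if_bool[of P "\<lambda>z. True" Q]]) (auto simp: decid_const)

lemma decid_le [tc]:
  assumes "tcomp f" "tcomp g" shows "decid (\<lambda>z. f z \<le> (g z :: nat))"
  unfolding decid_def
proof (rule back_subst[where P = tcomp])
  show "tcomp (\<lambda>z. 1 - (f z - g z))" by (intro tc assms)
qed auto

lemma decid_less [tc]: "tcomp f \<Longrightarrow> tcomp g \<Longrightarrow> decid (\<lambda>z. f z < (g z :: nat))"
  using decid_le[OF tcomp_Suc] by (simp add: Suc_le_eq)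

lemma decid_eq [tc]:
  assumes "tcomp f" "tcomp g" shows "decid (\<lambda>z. f z = g z)"
proof -
  have "decid (\<lambda>z. enc (f z) \<le> enc (g z) \<and> enc (g z) \<le> enc (f z))"
    by (intro tc assms)
  then show ?thesis by (simp flip: eq_iff)
qed

lemma tcomp_Least [tc]:
  assumes P: "decid (\<lambda>w. P (fst w) (snd w))" and ex: "\<And>z. \<exists>i. P z i"
  shows "tcomp (\<lambda>z. LEAST i. P z i :: nat)"
proof -
  define G where "G n = (\<lambda>w. if P (fst w) (snd w) then 0 else 1 :: nat) (dec n)" for n
  have "tcomp (\<lambda>w. if P (fst w) (snd w) then 0 else 1 :: nat)"
    by (intro tc P)
  then have G_trec: "trec G" unfolding tcomp_def G_def by simp
  have "recfn (Suc 1) (\<lambda>xs. G (prod_encode (xs ! 1, xs ! 0)))"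
    by (rule trec_recfn[OF G_trec]) (intro recfn_prod_encode recfn_proj; simp)
  moreover have G: "G (prod_encode (n, i)) = 0 \<longleftrightarrow> P (dec n) i" for n i
    using dec_enc[of "(dec n :: 'a, i)"] by (simp add: G_def)
  ultimately have "recfn 1 (\<lambda>xs. LEAST i. P (dec (xs ! 0)) i)"
    using recfn_Least[of 1 "\<lambda>xs. G (prod_encode (xs ! 1, xs ! 0))"] ex by simp
  then show ?thesis unfolding tcomp_def trec_def
    by (rule recfn_cong) (metis enc_nat_simp hd_conv_nth list.size(3) zero_neq_one)
qed

lemma tcomp_card [tc]:
  fixes P :: "'a::enc \<Rightarrow> nat \<Rightarrow> bool"
  assumes b: "tcomp b" and P: "decid (\<lambda>w. P (fst w) (snd w))"
  shows "tcomp (\<lambda>z. card {i. i < b z \<and> P z i})"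
proof -
  have "decid (\<lambda>w :: 'a \<times> nat \<times> nat. P (fst w) (fst (snd w)))"
    using decid_comp[OF P, of "\<lambda>w. (fst w, fst (snd w))"] by (simp add: tc)
  then have "tcomp (\<lambda>z. rec_nat 0 (\<lambda>n r. r + (if P z n then 1 else 0 :: nat)) (b z))"
    by (intro tc b)
  moreover have "rec_nat 0 (\<lambda>n r. r + (if Q n then 1 else 0 :: nat)) m = card {i. i < m \<and> Q i}" for Q m
  proof (induction m)
    case (Suc m)
    have "{i. i < Suc m \<and> Q i} = (if Q m then insert m else id) {i. i < m \<and> Q i}"
      by (auto simp: less_Suc_eq)
    then show ?case using Suc by simp
  qed simp
  ultimately show ?thesis by simp
qed

lemma decid_ex_less [tc]:
  fixes P :: "'a::enc \<Rightarrow> nat \<Rightarrow> bool"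
  assumes "tcomp b" "decid (\<lambda>w. P (fst w) (snd w))"
  shows "decid (\<lambda>z. \<exists>i<b z. P z i)"
proof -
  have "decid (\<lambda>z. 0 < card {i. i < b z \<and> P z i})"
    by (intro tc assms)
  then show ?thesis by (simp add: card_gt_0_iff)
qed

lemma decid_all_less [tc]:
  fixes P :: "'a::enc \<Rightarrow> nat \<Rightarrow> bool"
  assumes "tcomp b" "decid (\<lambda>w. P (fst w) (snd w))"
  shows "decid (\<lambda>z. \<forall>i<b z. P z i)"
proof -
  have "decid (\<lambda>z. \<not> (\<exists>i<b z. \<not> P z i))"
    by (intro tc assms)
  then show ?thesis by simp
qed

section \<open>Lists\<close>

lemma tcomp_Cons [tc]: "tcomp f \<Longrightarrow> tcomp g \<Longrightarrow> tcomp (\<lambda>z. f z # g z)"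
  unfolding tcomp_def trec_def enc_Cons by (intro recfn_Suc recfn_prod_encode)

lemma tcomp_hd [tc]:
  fixes f :: "'a::enc \<Rightarrow> 'b::enc list"
  assumes "tcomp f" shows "tcomp (\<lambda>z. hd (f z))"
proof -
  \<comment> \<open>\<open>hd []\<close> is unspecified but one fixed value, so it can be built in
    as the answer for the code 0.\<close>
  have "hd xs = (if enc xs = 0 then hd [] else dec (fst (dec (enc xs - 1) :: nat \<times> nat)))" for xs :: "'b list"
  proof (cases xs)
    case (Cons y ys)
    have "dec (prod_encode (enc y, enc ys)) = (enc y, enc ys)"
      using dec_enc[of "(enc y, enc ys)"] by simp
    with Cons show ?thesis by simp
  qed simp
  then have "(\<lambda>z. hd (f z)) = (\<lambda>z. if enc (f z) = 0 then hd [] else dec (fst (dec (enc (f z) - 1) :: nat \<times> nat)))"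
    by (rule ext)
  moreover have "tcomp \<dots>" by (intro tc assms)
  ultimately show ?thesis by simp
qed

lemma tcomp_tl [tc]:
  fixes f :: "'a::enc \<Rightarrow> 'b::enc list"
  assumes "tcomp f" shows "tcomp (\<lambda>z. tl (f z))"
proof -
  have "tl xs = (if enc xs = 0 then [] else dec (snd (dec (enc xs - 1) :: nat \<times> nat)))" for xs :: "'b list"
  proof (cases xs)
    case (Cons y ys)
    have "dec (prod_encode (enc y, enc ys)) = (enc y, enc ys)"
      using dec_enc[of "(enc y, enc ys)"] by simp
    with Cons show ?thesis by simp
  qed simp
  then have "(\<lambda>z. tl (f z)) = (\<lambda>z. if enc (f z) = 0 then [] else dec (snd (dec (enc (f z) - 1) :: nat \<times> nat)))"
    by (rule ext)
  moreover have "tcomp \<dots>" by (intro tc assms)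
  ultimately show ?thesis by simp
qed

lemma tcomp_drop [tc]:
  assumes "tcomp b" "tcomp f" shows "tcomp (\<lambda>z. drop (b z) (f z))"
proof -
  have "rec_nat xs (\<lambda>n r. tl r) m = drop m xs" for m and xs :: "'b list"
    by (induction m) (simp_all add: drop_Suc tl_drop)
  moreover have "tcomp (\<lambda>z. rec_nat (f z) (\<lambda>n r. tl r) (b z))"
    by (intro tc assms)
  ultimately show ?thesis by simp
qed

lemma tcomp_length [tc]:
  assumes "tcomp f" shows "tcomp (\<lambda>z. length (f z))"
proof -
  have "tcomp (\<lambda>z. LEAST i. drop i (f z) = [])"
    by (intro tc tcomp_comp[OF assms]) (auto intro: exI[of _ "length (f z)" for z])
  moreover have "(LEAST i. drop i xs = []) = length xs" for xs :: "'b list"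
    by (rule Least_equality) auto
  ultimately show ?thesis by simp
qed

text \<open>An out-of-range \<^term>\<open>xs ! i\<close> is unspecified, so indexing is expressed by
  \<^term>\<open>hd (drop i xs)\<close>, which is computable for every index.\<close>

lemma decid_bex_set [tc]:
  assumes "tcomp f" "decid (\<lambda>w. P (fst w) (snd w))"
  shows "decid (\<lambda>z. \<exists>x\<in>set (f z). P z x)"
proof -
  have *: "decid (\<lambda>w. P (fst w) (hd (drop (snd w) (f (fst w)))))"
    using decid_comp[OF assms(2), of "\<lambda>w. (fst w, hd (drop (snd w) (f (fst w))))"]
    by (simp add: tc tcomp_comp[OF assms(1)])
  have "decid (\<lambda>z. \<exists>i<length (f z). P z (hd (drop i (f z))))"
    by (intro tc assms *)
  moreover have "(\<exists>i<length xs. Q (hd (drop i xs))) \<longleftrightarrow> (\<exists>x\<in>set xs. Q x)" for Q and xs :: "'b list"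
    by (metis hd_drop_conv_nth in_set_conv_nth)
  ultimately show ?thesis by simp
qed

lemma decid_mem [tc]:
  assumes "tcomp f" "tcomp g" shows "decid (\<lambda>z. g z \<in> set (f z))"
proof -
  have "decid (\<lambda>z. \<exists>x\<in>set (f z). x = g z)"
    by (intro tc assms tcomp_comp[OF assms(2)])
  then show ?thesis by simp
qed

section \<open>A universal partial computable function\<close>

lemma dec_prod_nat: "dec n = prod_decode n"
  by (metis dec_enc enc_Pair enc_nat_simp prod.collapse prod_decode_inverse)

lemma tcomp_prod_decode [tc]: "tcomp f \<Longrightarrow> tcomp (\<lambda>z. prod_decode (f z))"
  unfolding dec_prod_nat[symmetric] by (rule tcomp_dec)

fun code :: "recf \<Rightarrow> nat" where
  "code Zero = prod_encode (0, 0)"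
| "code Succ = prod_encode (1, 0)"
| "code (Proj i) = prod_encode (2, i)"
| "code (Comp f gs) = prod_encode (3, prod_encode (code f, enc (map code gs)))"
| "code (Prim f g) = prod_encode (4, prod_encode (code f, code g))"
| "code (Mu f) = prod_encode (5, code f)"

text \<open>A fact \<open>(e, xs, y)\<close> asserts that the function with code \<open>e\<close> maps \<open>xs\<close> to \<open>y\<close>.  A derivation
  is a list of facts, each of which follows by one rule of \<^const>\<open>rec_eval\<close> from facts further
  down the list.  Checking a derivation only needs bounded quantifiers.\<close>

type_synonym fact = "nat \<times> nat list \<times> nat"

definition justified :: "fact list \<Rightarrow> nat \<Rightarrow> nat list \<Rightarrow> nat \<Rightarrow> bool" where
  "justified D e xs y \<longleftrightarrow>
     (pfst e = 0 \<and> y = 0) \<or>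
     (pfst e = 1 \<and> xs \<noteq> [] \<and> y = Suc (hd xs)) \<or>
     (pfst e = 2 \<and> psnd e < length xs \<and> y = hd (drop (psnd e) xs)) \<or>
     (pfst e = 3 \<and> (\<exists>q\<in>set D. fst q = pfst (psnd e) \<and> snd (snd q) = y \<and>
        length (fst (snd q)) = length (dec (psnd (psnd e)) :: nat list) \<and>
        (\<forall>j<length (fst (snd q)). (hd (drop j (dec (psnd (psnd e)))), xs, hd (drop j (fst (snd q)))) \<in> set D))) \<or>
     (pfst e = 4 \<and> xs \<noteq> [] \<and> hd xs = 0 \<and> (pfst (psnd e), tl xs, y) \<in> set D) \<or>
     (pfst e = 4 \<and> xs \<noteq> [] \<and> hd xs \<noteq> 0 \<and> (\<exists>q\<in>set D. fst q = e \<and> fst (snd q) = (hd xs - 1) # tl xs \<and>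
        (psnd (psnd e), snd (snd q) # (hd xs - 1) # tl xs, y) \<in> set D)) \<or>
     (pfst e = 5 \<and> (psnd e, y # xs, 0) \<in> set D \<and>
        (\<forall>m<y. \<exists>q\<in>set D. fst q = psnd e \<and> fst (snd q) = m # xs \<and> snd (snd q) \<noteq> 0))"

definition derivation :: "fact list \<Rightarrow> bool" where
  "derivation D \<longleftrightarrow> (\<forall>i<length D. justified (drop (Suc i) D)
     (fst (hd (drop i D))) (fst (snd (hd (drop i D)))) (snd (snd (hd (drop i D)))))"

lemma decid_justified [tc]:
  assumes "tcomp d" "tcomp e" "tcomp x" "tcomp y"
  shows "decid (\<lambda>z. justified (d z) (e z) (x z) (y z))"
proof -
  have "decid (\<lambda>z. justified (fst z) (fst (snd z)) (fst (snd (snd z))) (snd (snd (snd z))))"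
    unfolding justified_def by (intro tc)
  from decid_comp[OF this, of "\<lambda>z. (d z, e z, x z, y z)"] show ?thesis
    by (simp add: tcomp_Pair assms)
qed

lemma decid_derivation [tc]:
  assumes "tcomp d" shows "decid (\<lambda>z. derivation (d z))"
proof (rule decid_comp[OF _ assms])
  show "decid derivation" unfolding derivation_def[abs_def] by (intro tc)
qed

lemma derivation_Nil [simp]: "derivation []"
  by (simp add: derivation_def)

lemma derivation_Cons [simp]:
  "derivation ((e, xs, y) # D) \<longleftrightarrow> justified D e xs y \<and> derivation D"
  unfolding derivation_def length_Cons All_less_Suc2 by simp

text \<open>Premises occur only positively, so further facts never spoil a step. This is why
  derivations of several premises can simply be concatenated.\<close>

lemma justified_mono:
  assumes "justified D e xs y" "set D \<subseteq> set D'"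
  shows "justified D' e xs y"
proof -
  have *: "\<And>q. q \<in> set D \<Longrightarrow> q \<in> set D'" using assms(2) by blast
  show ?thesis using assms(1) unfolding justified_def
    by (elim disjE) (metis *)+
qed

lemma derivation_append: "derivation D \<Longrightarrow> derivation D' \<Longrightarrow> derivation (D @ D')"
proof (induction D)
  case (Cons q D)
  then show ?case by (cases q) (auto elim: justified_mono)
qed simp

definition derivable :: "fact \<Rightarrow> bool" where
  "derivable q \<longleftrightarrow> (\<exists>D. derivation D \<and> q \<in> set D)"

lemma derivable_if_justified:
  assumes "justified G e xs y" "\<And>q. q \<in> set G \<Longrightarrow> derivable q"
  shows "derivable (e, xs, y)"
proof -
  have "\<exists>D. derivation D \<and> set G \<subseteq> set D"
    using assms(2)
  proof (induction G)
    case Nil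
    show ?case by (rule exI[of _ "[]"]) simp
  next
    case (Cons q G)
    obtain D where D: "derivation D" "set G \<subseteq> set D" using Cons by auto
    obtain D' where D': "derivation D'" "q \<in> set D'" using Cons.prems[of q] by (auto simp: derivable_def)
    from derivation_append[OF D(1) D'(1)] D(2) D'(2) show ?case
      by (intro exI[of _ "D @ D'"]) auto
  qed
  then obtain D where D: "derivation D" "set G \<subseteq> set D" by blast
  then have "derivation ((e, xs, y) # D)" using justified_mono[OF assms(1)] by simp
  then show ?thesis unfolding derivable_def by (meson list.set_intros(1))
qed

lemma derivable_rec_eval:
  "rec_eval r xs y \<Longrightarrow> derivable (code r, xs, y)"
  "rec_evals rs xs ys \<Longrightarrow> length rs = length ys \<and> (\<forall>j<length rs. derivable (code (rs ! j), xs, ys ! j))"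
proof (induction rule: rec_eval_rec_evals.inducts)
  case (ev_zero xs)
  show ?case by (rule derivable_if_justified[of "[]"]) (auto simp: justified_def)
next
  case (ev_succ x xs)
  show ?case by (rule derivable_if_justified[of "[]"]) (auto simp: justified_def)
next
  case (ev_proj i xs)
  then show ?case
    by (intro derivable_if_justified[of "[]"]) (auto simp: justified_def hd_drop_conv_nth)
next
  case (ev_comp gs xs ys f y)
  show ?case
    by (rule derivable_if_justified[of "(code f, ys, y) # map (\<lambda>j. (code (gs ! j), xs, ys ! j)) [0..<length ys]"])
      (use ev_comp.IH in \<open>auto simp: justified_def hd_drop_conv_nth image_iff\<close>)
next
  case (evs_nil xs)
  show ?case by simp
next
  case (evs_cons g xs y gs ys)
  then show ?case by (auto simp: nth_Cons split: nat.splits)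
next
  case (ev_prim0 f xs y g)
  then show ?case
    by (intro derivable_if_justified[of "[(code f, xs, y)]"]) (auto simp: justified_def)
next
  case (ev_primS f g n xs z y)
  then show ?case
    by (intro derivable_if_justified[of "[(code (Prim f g), n # xs, z), (code g, z # n # xs, y)]"])
      (auto simp: justified_def)
next
  case (ev_mu f n xs)
  from ev_mu.IH(2) obtain k where k: "\<And>m. m < n \<Longrightarrow> derivable (code f, m # xs, Suc (k m))" by metis
  show ?case
    by (rule derivable_if_justified[of "(code f, n # xs, 0) # map (\<lambda>m. (code f, m # xs, Suc (k m))) [0..<n]"])
      (use ev_mu.IH(1) k in \<open>auto simp: justified_def\<close>)
qed

lemma rec_evalsI:
  "length rs = length ys \<Longrightarrow> (\<And>j. j < length rs \<Longrightarrow> rec_eval (rs ! j) xs (ys ! j)) \<Longrightarrow> rec_evals rs xs ys"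
proof (induction rs ys rule: list_induct2)
  case (Cons r rs y ys)
  from Cons.prems[of 0] have "rec_eval r xs y" by simp
  moreover have "rec_evals rs xs ys" using Cons.IH Cons.prems[of "Suc j" for j] by simp
  ultimately show ?case by (rule evs_cons)
qed (rule evs_nil)

text \<open>A derivation may also contain facts about numbers that are no codes. They do no harm: a
  fact about \<open>code r\<close> is justified by facts about \<open>r\<close> itself or its
  immediate subterms only, which are again codes.\<close>

lemma rec_eval_derivation:
  "derivation D \<Longrightarrow> (code r, xs, y) \<in> set D \<Longrightarrow> rec_eval r xs y"
proof (induction D arbitrary: r xs y)
  case (Cons q D)
  obtain e' xs' y' where q: "q = (e', xs', y')" by (cases q)
  have IH: "rec_eval r xs y" if "(code r, xs, y) \<in> set D" for r xs y
    using Cons that by (simp add: q)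
  show ?case
  proof (cases "(code r, xs, y) \<in> set D")
    case False
    then have J: "justified D (code r) xs y" using Cons.prems q by auto
    show ?thesis
    proof (cases r)
      case Zero
      then show ?thesis using J by (auto simp: justified_def intro: ev_zero)
    next
      case Succ
      then show ?thesis using J by (cases xs) (auto simp: justified_def intro: ev_succ)
    next
      case (Proj i)
      then show ?thesis using J ev_proj[of i xs] by (auto simp: justified_def hd_drop_conv_nth)
    next
      case (Comp f gs)
      with J obtain ys where "(code f, ys, y) \<in> set D" "length ys = length gs"
        and "\<forall>j<length ys. (hd (drop j (map code gs)), xs, hd (drop j ys)) \<in> set D"
        by (auto simp: justified_def)
      then have "rec_eval f ys y" "rec_evals gs xs ys"
        by (auto intro!: IH rec_evalsI simp: hd_drop_conv_nth)
      then show ?thesis using Comp ev_comp by blast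
    next
      case (Prim f g)
      show ?thesis
      proof (cases xs)
        case Nil
        then show ?thesis using J Prim by (simp add: justified_def)
      next
        case (Cons n zs)
        show ?thesis
        proof (cases n)
          case 0
          then show ?thesis using J Prim Cons by (auto simp: justified_def intro: ev_prim0[OF IH])
        next
          case (Suc m)
          with J Prim Cons obtain z where "(code (Prim f g), m # zs, z) \<in> set D" "(code g, z # m # zs, y) \<in> set D"
            by (auto simp: justified_def)
          from ev_primS[OF IH[OF this(1)] IH[OF this(2)]] show ?thesis using Prim Cons Suc by simp
        qed
      qed
    next
      case (Mu f)
      with J have "rec_eval f (y # xs) 0" by (auto simp: justified_def intro: IH)
      moreover have "\<forall>m<y. \<exists>k. rec_eval f (m # xs) (Suc k)"
      proof (intro allI impI)
        fix m assume "m < y"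
        then have "\<exists>q\<in>set D. fst q = code f \<and> fst (snd q) = m # xs \<and> snd (snd q) \<noteq> 0"
          using J Mu by (simp add: justified_def)
        then obtain k where "(code f, m # xs, k) \<in> set D" "k \<noteq> 0" by auto
        then show "\<exists>k. rec_eval f (m # xs) (Suc k)" using IH not0_implies_Suc by blast
      qed
      ultimately show ?thesis using Mu ev_mu by blast
    qed
  qed (rule IH)
qed simp

definition halt_code :: "nat \<Rightarrow> nat \<Rightarrow> nat \<Rightarrow> bool" where
  "halt_code e x w \<longleftrightarrow> derivation (snd (dec w :: nat \<times> fact list)) \<and>
     (e, [x], fst (dec w :: nat \<times> fact list)) \<in> set (snd (dec w :: nat \<times> fact list))"

definition out_code :: "nat \<Rightarrow> nat" where
  "out_code w = fst (dec w :: nat \<times> fact list)"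

text \<open>Taking the output of the least witness makes \<open>phi e\<close> single-valued for
  every number \<open>e\<close>, without asking whether \<open>e\<close> is a code.\<close>

definition phi :: "nat \<Rightarrow> nat \<Rightarrow> nat option" where
  "phi e x = (if \<exists>w. halt_code e x w then Some (out_code (LEAST w. halt_code e x w)) else None)"

text \<open>The bound \<open>s\<close> on the halting witness replaces a number of steps: the
  relation is decidable, monotone in \<open>s\<close>, and false at stage 0.\<close>

definition halts :: "nat \<Rightarrow> nat \<Rightarrow> nat \<Rightarrow> bool" where
  "halts s e x \<longleftrightarrow> (\<exists>w<s. halt_code e x w)"

definition runs :: "nat \<Rightarrow> nat \<Rightarrow> nat \<Rightarrow> nat \<Rightarrow> bool" where
  "runs s e x y \<longleftrightarrow> (\<exists>w<s. halt_code e x w \<and> (\<forall>v<w. \<not> halt_code e x v) \<and> y = out_code w)"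

lemma decid_halt_code [tc]:
  assumes "tcomp e" "tcomp x" "tcomp w"
  shows "decid (\<lambda>z. halt_code (e z) (x z) (w z))"
proof -
  have "decid (\<lambda>z. halt_code (fst z) (fst (snd z)) (snd (snd z)))"
    unfolding halt_code_def by (intro tc)
  from decid_comp[OF this, of "\<lambda>z. (e z, x z, w z)"] show ?thesis by (simp add: tcomp_Pair assms)
qed

lemma decid_halts [tc]:
  assumes "tcomp s" "tcomp e" "tcomp x"
  shows "decid (\<lambda>z. halts (s z) (e z) (x z))"
proof -
  have "decid (\<lambda>z. halts (fst z) (fst (snd z)) (snd (snd z)))"
    unfolding halts_def by (intro tc)
  from decid_comp[OF this, of "\<lambda>z. (s z, e z, x z)"] show ?thesis by (simp add: tcomp_Pair assms)
qed

lemma decid_runs [tc]: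
  assumes "tcomp s" "tcomp e" "tcomp x" "tcomp y"
  shows "decid (\<lambda>z. runs (s z) (e z) (x z) (y z))"
proof -
  have "decid (\<lambda>z. runs (fst z) (fst (snd z)) (fst (snd (snd z))) (snd (snd (snd z))))"
    unfolding runs_def out_code_def by (intro tc)
  from decid_comp[OF this, of "\<lambda>z. (s z, e z, x z, y z)"] show ?thesis by (simp add: tcomp_Pair assms)
qed

lemma halts_mono: "halts s e x \<Longrightarrow> s \<le> t \<Longrightarrow> halts t e x"
  unfolding halts_def by (meson less_le_trans)

lemma phi_eq_Some_iff: "phi e x = Some y \<longleftrightarrow> (\<exists>s. runs s e x y)"
proof
  assume "phi e x = Some y"
  then have ex: "\<exists>w. halt_code e x w" and y: "y = out_code (LEAST w. halt_code e x w)"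
    by (auto simp: phi_def split: if_splits)
  have "runs (Suc (LEAST w. halt_code e x w)) e x y"
    unfolding runs_def using LeastI_ex[OF ex] not_less_Least y by blast
  then show "\<exists>s. runs s e x y" ..
next
  assume "\<exists>s. runs s e x y"
  then obtain w where w: "halt_code e x w" "\<forall>v<w. \<not> halt_code e x v" "y = out_code w"
    by (auto simp: runs_def)
  then have "(LEAST w. halt_code e x w) = w" by (metis LeastI not_less_Least linorder_neqE_nat)
  then show "phi e x = Some y" using w by (auto simp: phi_def)
qed

lemma runs_phi: "runs s e x y \<Longrightarrow> phi e x = Some y"
  using phi_eq_Some_iff by blast

lemma halts_runs_iff: "halts s e x \<longleftrightarrow> (\<exists>y. runs s e x y)"
proof
  assume "halts s e x"
  then obtain w where w: "w < s" "halt_code e x w" by (auto simp: halts_def)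
  have "(LEAST w. halt_code e x w) < s" using w Least_le[of "halt_code e x" w] by linarith
  then have "runs s e x (out_code (LEAST w. halt_code e x w))"
    unfolding runs_def using w LeastI[of "halt_code e x" w] not_less_Least by blast
  then show "\<exists>y. runs s e x y" ..
qed (auto simp: halts_def runs_def)

lemma phi_halts_iff: "phi e x \<noteq> None \<longleftrightarrow> (\<exists>s. halts s e x)"
  using phi_eq_Some_iff halts_runs_iff by (metis not_None_eq)

lemma phi_code:
  assumes "\<And>x y. rec_eval r [x] y \<longleftrightarrow> v x = Some y"
  shows "phi (code r) = v"
proof (rule ext)
  have *: "v x = Some y \<longleftrightarrow> (\<exists>w. halt_code (code r) x w \<and> out_code w = y)" for x y
  proof
    assume "v x = Some y"
    then have "derivable (code r, [x], y)" using assms derivable_rec_eval(1) by blast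
    then obtain D where "derivation D" "(code r, [x], y) \<in> set D" by (auto simp: derivable_def)
    then have "halt_code (code r) x (enc (y, D)) \<and> out_code (enc (y, D)) = y"
      unfolding halt_code_def out_code_def dec_enc by simp
    then show "\<exists>w. halt_code (code r) x w \<and> out_code w = y" by blast
  next
    assume "\<exists>w. halt_code (code r) x w \<and> out_code w = y"
    then show "v x = Some y"
      unfolding halt_code_def out_code_def using assms rec_eval_derivation by blast
  qed
  show "phi (code r) x = v x" for x
  proof (cases "\<exists>w. halt_code (code r) x w")
    case True
    then have "halt_code (code r) x (LEAST w. halt_code (code r) x w)" by (rule LeastI_ex)
    with * show ?thesis by (simp add: phi_def) metis
  next
    case False
    then show ?thesis using *[of x] by (cases "v x") (auto simp: phi_def)
  qed
qed

text \<open>\<open>Mu\<close> searches for the least code of a pair \<open>(y, s)\<close> with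
  \<open>P x y s\<close>, and its first component is returned. Whichever pair is found first is
  right, since by the second assumption all of them share the same \<open>y\<close>.\<close>

lemma ex_rec_eval_graph:
  fixes P :: "nat \<Rightarrow> nat \<Rightarrow> 's::enc \<Rightarrow> bool"
  assumes P: "decid (\<lambda>z. P (fst z) (fst (snd z)) (snd (snd z)))"
    and v: "\<And>x y. v x = Some y \<longleftrightarrow> (\<exists>s. P x y s)"
  shows "\<exists>r. \<forall>x y. rec_eval r [x] y \<longleftrightarrow> v x = Some y"
proof -
  define Q where "Q x w \<longleftrightarrow> P x (fst (dec w :: nat \<times> 's)) (snd (dec w :: nat \<times> 's))" for x w
  have "decid (\<lambda>z. Q (fst z) (snd z))"
    unfolding Q_def using decid_comp[OF P, of "\<lambda>z. (fst z, dec (snd z))"] by (simp add: tc)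
  then have "trec (\<lambda>n. (\<lambda>z. if Q (fst z) (snd z) then 0 else 1 :: nat) (dec n))"
    using tcomp_If[of "\<lambda>z. Q (fst z) (snd z)" "\<lambda>_. 0 :: nat" "\<lambda>_. 1"] by (simp add: tcomp_def[symmetric] tc tcomp_def)
  then have "recfn 2 (\<lambda>xs. (\<lambda>z. if Q (fst z) (snd z) then 0 else 1 :: nat) (dec (prod_encode (xs ! 1, xs ! 0))))"
    by (rule trec_recfn) (intro recfn_prod_encode recfn_proj; simp)
  moreover have "dec (prod_encode (a, b)) = (a, b)" for a b :: nat
    using dec_enc[of "(a, b)"] by simp
  ultimately obtain F where F: "\<And>xs. length xs = 2 \<Longrightarrow> rec_eval F xs (if Q (xs ! 1) (xs ! 0) then 0 else 1)"
    unfolding recfn_def by auto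
  then have F: "rec_eval F [w, x] (if Q x w then 0 else 1)" for w x
    using F[of "[w, x]"] by simp
  have "trec (\<lambda>n. fst (dec n :: nat \<times> 's))"
    using tcomp_fst[OF tcomp_dec[OF tcomp_id], where 'c = 's and 'b = nat] unfolding tcomp_def by simp
  then obtain G where G: "\<And>n. rec_eval G [n] (fst (dec n :: nat \<times> 's))"
    unfolding trec_iff by blast
  have Mu: "rec_eval (Mu F) [x] w \<longleftrightarrow> Q x w \<and> (\<forall>v<w. \<not> Q x v)" for x w
  proof
    assume "rec_eval (Mu F) [x] w"
    then show "Q x w \<and> (\<forall>v<w. \<not> Q x v)"
    proof (rule rec_eval_elims(6))
      assume *: "rec_eval F (w # [x]) 0" "\<forall>m<w. \<exists>k. rec_eval F (m # [x]) (Suc k)"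
      have "Q x w" using rec_eval_det(1)[OF *(1) F] by (auto split: if_splits)
      moreover have "\<not> Q x m" if m: "m < w" for m
      proof -
        obtain k where "rec_eval F [m, x] (Suc k)" using * m by blast
        from rec_eval_det(1)[OF this F] show ?thesis by (auto split: if_splits)
      qed
      ultimately show ?thesis by blast
    qed
  next
    assume *: "Q x w \<and> (\<forall>v<w. \<not> Q x v)"
    show "rec_eval (Mu F) [x] w"
    proof (rule ev_mu)
      show "rec_eval F [w, x] 0" using F[of w x] * by simp
      show "\<forall>m<w. \<exists>k. rec_eval F [m, x] (Suc k)" using F * by (metis One_nat_def)
    qed
  qed
  have "rec_eval (Comp G [Mu F]) [x] y \<longleftrightarrow> v x = Some y" for x y
  proof
    assume "rec_eval (Comp G [Mu F]) [x] y"
    then obtain w where w: "rec_eval (Mu F) [x] w" "rec_eval G [w] y"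
      by (auto elim!: rec_eval_elims(4) rec_eval_elims(7,8))
    then have "y = fst (dec w :: nat \<times> 's)" using G rec_eval_det(1) by blast
    then show "v x = Some y" using w Mu v unfolding Q_def by blast
  next
    assume y: "v x = Some y"
    then obtain s where s: "P x y s" using v by blast
    then have "Q x (enc (y, s))" unfolding Q_def dec_enc by simp
    then have L: "Q x (LEAST w. Q x w)" by (rule LeastI)
    then have "rec_eval (Mu F) [x] (LEAST w. Q x w)" using Mu not_less_Least by blast
    moreover have "fst (dec (LEAST w. Q x w) :: nat \<times> 's) = y"
      using L v y unfolding Q_def by (metis option.inject)
    ultimately show "rec_eval (Comp G [Mu F]) [x] y"
      using G by (metis ev_comp evs_cons evs_nil)
  qed
  then show ?thesis by blast
qed

lemma ex_phi_graph:
  fixes P :: "nat \<Rightarrow> nat \<Rightarrow> 's::enc \<Rightarrow> bool"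
  assumes "decid (\<lambda>z. P (fst z) (fst (snd z)) (snd (snd z)))"
    and "\<And>x y. v x = Some y \<longleftrightarrow> (\<exists>s. P x y s)"
  shows "\<exists>e. phi e = v"
  using ex_rec_eval_graph[of P v] assms phi_code by blast

text \<open>With \<open>phi_code\<close> this identifies the functions \<open>phi e\<close> with the
  partial recursive ones, so quantifying over machines becomes quantifying over indices.\<close>

lemma ex_rec_eval_phi: "\<exists>r. \<forall>x y. rec_eval r [x] y \<longleftrightarrow> phi e x = Some y"
  by (rule ex_rec_eval_graph[of "\<lambda>x y s. runs s e x y"]) (intro tc, rule phi_eq_Some_iff)

lemma ex_phi_total:
  assumes "tcomp f" shows "\<exists>e. \<forall>x. phi e x = Some (f x)"
proof -
  have "\<exists>e. phi e = (\<lambda>x. Some (f x))"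
    by (rule ex_phi_graph[of "\<lambda>x y s :: nat. y = f x"]) (intro tc tcomp_comp[OF assms], auto)
  then obtain e where "phi e = (\<lambda>x. Some (f x))" ..
  then have "\<forall>x. phi e x = Some (f x)" by simp
  then show ?thesis ..
qed

lemma tcomp_phi_total:
  assumes "\<And>x. phi e x = Some (f x)" shows "tcomp f"
proof -
  have ex: "\<exists>w. runs (pfst w) e x (psnd w)" for x
    using assms phi_eq_Some_iff prod_encode_inverse by (metis fst_conv snd_conv)
  have "tcomp (\<lambda>x. psnd (LEAST w. runs (pfst w) e x (psnd w)))"
    by (intro tc ex)
  moreover have "psnd (LEAST w. runs (pfst w) e x (psnd w)) = f x" for x
  proof -
    have "phi e x = Some (psnd (LEAST w. runs (pfst w) e x (psnd w)))"
      by (rule runs_phi[OF LeastI_ex[OF ex[of x]]])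
    with assms show ?thesis by simp
  qed
  ultimately show ?thesis by simp
qed

section \<open>Strings as natural numbers\<close>

lemma str_to_nat_inj: "str_to_nat x = str_to_nat y \<Longrightarrow> x = y"
proof (induction x arbitrary: y)
  case Nil
  then show ?case by (cases y) (auto split: if_splits)
next
  case (Cons b x)
  then obtain b' y' where y: "y = b' # y'" by (cases y) (auto split: if_splits)
  with Cons.prems have "b = b'" by (auto split: if_splits) presburger+
  with Cons y show ?case by auto
qed

lemma str_to_nat_surj: "\<exists>x. str_to_nat x = n"
proof (induction n rule: less_induct)
  case (less n)
  show ?case
  proof (cases n)
    case 0
    then show ?thesis by (intro exI[of _ "[]"]) simp
  next
    case (Suc m)
    then have "m div 2 < n" by simp
    with less obtain x where "str_to_nat x = m div 2" by blast
    then have "str_to_nat (odd m # x) = n" using Suc by simp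
    then show ?thesis ..
  qed
qed

lemma str_to_nat_nat_to_str [simp]: "str_to_nat (nat_to_str n) = n"
proof -
  obtain x where "str_to_nat x = n" using str_to_nat_surj by blast
  then show ?thesis unfolding nat_to_str_def by (metis (mono_tags, lifting) str_to_nat_inj theI)
qed

lemma nat_to_str_str_to_nat [simp]: "nat_to_str (str_to_nat x) = x"
  by (rule str_to_nat_inj) simp

lemma nat_to_str_eq_iff [simp]: "nat_to_str m = nat_to_str n \<longleftrightarrow> m = n"
  by (metis str_to_nat_nat_to_str)

definition len :: "nat \<Rightarrow> nat" where "len n = length (nat_to_str n)"

lemma len_str_to_nat [simp]: "len (str_to_nat x) = length x"
  by (simp add: len_def)

lemma len_double: "len (2 * n + 1) = len n + 1" "len (2 * n + 2) = len n + 1"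
proof -
  have "2 * n + 1 = str_to_nat (False # nat_to_str n)" "2 * n + 2 = str_to_nat (True # nat_to_str n)"
    by simp_all
  then show "len (2 * n + 1) = len n + 1" "len (2 * n + 2) = len n + 1"
    by (simp_all only: len_str_to_nat) (simp_all add: len_def)
qed

lemma str_to_nat_bounds: "2 ^ length x \<le> str_to_nat x + 1" "str_to_nat x + 1 < 2 ^ Suc (length x)"
  by (induction x) auto

text \<open>The number of strings of length at most \<open>n\<close>. Shorter strings have smaller
  numbers, so these strings occupy exactly the numbers below \<open>strs n\<close>, and error
  fractions become counts in an initial segment.\<close>

definition strs :: "nat \<Rightarrow> nat" where "strs n = 2 ^ Suc n - 1"

lemma less_strs_iff: "k < strs n \<longleftrightarrow> len k \<le> n"
proof -
  have b: "2 ^ len k \<le> k + 1" "k + 1 < 2 ^ Suc (len k)"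
    using str_to_nat_bounds[of "nat_to_str k"] by (simp_all add: len_def)
  have "len k \<le> n" if "k + 1 < 2 ^ Suc n"
  proof -
    have "(2::nat) ^ len k < 2 ^ Suc n" using b that by linarith
    then have "len k < Suc n" by (rule power_less_imp_less_exp[rotated]) simp
    then show ?thesis by simp
  qed
  moreover have "k + 1 < 2 ^ Suc n" if "len k \<le> n"
  proof -
    have "(2::nat) ^ Suc (len k) \<le> 2 ^ Suc n" using that by (intro power_increasing) auto
    then show ?thesis using b by linarith
  qed
  ultimately show ?thesis unfolding strs_def by auto
qed

lemma strs_Suc: "strs (Suc n) = strs n + 2 ^ Suc n"
  by (simp add: strs_def)

lemma strs_pos: "2 ^ n \<le> strs n"
  by (induction n) (auto simp: strs_Suc, simp add: strs_def)

lemma strs_le: "strs n \<le> 2 ^ Suc n"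
  by (simp add: strs_def)

lemma tcomp_strs [tc]: "tcomp f \<Longrightarrow> tcomp (\<lambda>z. strs (f z))"
  unfolding strs_def by (intro tc)

lemma len_eq_Least: "len k = (LEAST n. k < strs n)"
  by (rule Least_equality[symmetric]) (auto simp: less_strs_iff)

lemma tcomp_len [tc]: "tcomp f \<Longrightarrow> tcomp (\<lambda>z. len (f z))"
proof (erule tcomp_comp[rotated])
  show "tcomp len" unfolding len_eq_Least[abs_def]
    by (intro tc) (use less_strs_iff in blast)
qed

text \<open>\<open>pad i p\<close> is the number of the string that consists of \<open>i\<close> ones, a zero, and the string number \<open>p\<close>.\<close>

definition pad :: "nat \<Rightarrow> nat \<Rightarrow> nat" where "pad i p = 2 ^ i * (2 * p + 3) - 2"

lemma pad_0 [simp]: "pad 0 p = 2 * p + 1"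
  by (simp add: pad_def)

lemma pad_Suc [simp]: "pad (Suc i) p = 2 * pad i p + 2"
proof -
  have "1 * 2 \<le> 2 ^ i * (2 * p + 3)"
    by (rule mult_le_mono) simp_all
  then show ?thesis by (simp add: pad_def algebra_simps)
qed

lemma len_pad [simp]: "len (pad i p) = i + 1 + len p"
proof (induction i)
  case 0
  then show ?case using len_double(1)[of p] by simp
next
  case (Suc i)
  then show ?case using len_double(2)[of "pad i p"] by simp
qed

lemma pad_inject [simp]: "pad i p = pad j q \<longleftrightarrow> i = j \<and> p = q"
proof (induction i arbitrary: j)
  case 0
  show ?case by (cases j) (auto, presburger)
next
  case (Suc i)
  show ?case
  proof (cases j)
    case 0
    then show ?thesis by auto presburger
  next
    case (Suc j)
    then show ?thesis using Suc.IH[of j] by simp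
  qed
qed

lemma tcomp_pad [tc]: "tcomp f \<Longrightarrow> tcomp g \<Longrightarrow> tcomp (\<lambda>z. pad (f z) (g z))"
  unfolding pad_def by (intro tc)

text \<open>Within one length, lexicographic order is the order of binary values with the head as
  the most significant digit. In \<open>str_to_nat\<close> the head is the least significant one, so
  this is a second numbering.\<close>

fun lex_rank :: "bstr \<Rightarrow> nat" where
  "lex_rank [] = 0"
| "lex_rank (b # x) = of_bool b * 2 ^ length x + lex_rank x"

lemma lex_rank_less: "lex_rank x < 2 ^ length x"
  by (induction x) auto

lemma lexord_iff_lex_rank:
  "length y = length x \<Longrightarrow> ((y, x) \<in> lexord {(a, b). a < b} \<longleftrightarrow> lex_rank y < lex_rank x)
     \<and> (y = x \<longleftrightarrow> lex_rank y = lex_rank x)"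
proof (induction y x rule: list_induct2)
  case (Cons a y b x)
  have "lex_rank y < 2 ^ length x" "lex_rank x < 2 ^ length x"
    using lex_rank_less[of y] lex_rank_less[of x] Cons.hyps by simp_all
  with Cons show ?case by (cases a; cases b) auto
qed auto

lemma lex_le_iff: "length y = length x \<Longrightarrow> lex_le y x \<longleftrightarrow> lex_rank y \<le> lex_rank x"
  using lexord_iff_lex_rank[of y x] by (auto simp: lex_le_def)

lemma ex_lex_rank: "r < 2 ^ n \<Longrightarrow> \<exists>x. length x = n \<and> lex_rank x = r"
proof (induction n arbitrary: r)
  case (Suc n)
  show ?case
  proof (cases "r < 2 ^ n")
    case True
    with Suc.IH obtain x where "length x = n" "lex_rank x = r" by blast
    then show ?thesis by (intro exI[of _ "False # x"]) simp
  next
    case False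
    with Suc.prems have "r - 2 ^ n < 2 ^ n" by simp
    with Suc.IH obtain x where "length x = n" "lex_rank x = r - 2 ^ n" by blast
    with False show ?thesis by (intro exI[of _ "True # x"]) simp
  qed
qed simp

definition rank :: "nat \<Rightarrow> nat" where "rank n = lex_rank (nat_to_str n)"

text \<open>One step of Horner's scheme. For a positive string number \<open>n\<close>, the least
  \<open>i\<close> with \<open>n \<le> 2 * i + 2\<close> is the number of the tail, and equality
  holds iff the head is \<open>True\<close>.\<close>

definition rank_step :: "nat \<times> nat \<Rightarrow> nat \<times> nat" where
  "rank_step q = (LEAST i. fst q \<le> 2 * i + 2,
     if fst q = 0 then snd q else if fst q = 2 * (LEAST i. fst q \<le> 2 * i + 2) + 2 then 2 * snd q + 1 else 2 * snd q)"

lemma tcomp_rank [tc]: "tcomp f \<Longrightarrow> tcomp (\<lambda>z. rank (f z))"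
proof (erule tcomp_comp[rotated])
  have s: "(LEAST i. 2 * n + 1 \<le> 2 * i + 2) = n" "(LEAST i. 2 * n + 2 \<le> 2 * i + 2) = n" for n :: nat
    by (rule Least_equality; simp)+
  have step: "rank_step (0, v) = (0, v)" "rank_step (2 * n + 1, v) = (n, 2 * v)"
    "rank_step (2 * n + 2, v) = (n, 2 * v + 1)" for n v
    using s[of n] by (auto simp: rank_step_def)
  have "snd (rec_nat (str_to_nat x, v) (\<lambda>_. rank_step) (length x)) = v * 2 ^ length x + lex_rank x" for x v
  proof (induction x arbitrary: v)
    case (Cons b x)
    have shift: "rec_nat q (\<lambda>_. rank_step) (Suc m) = rec_nat (rank_step q) (\<lambda>_. rank_step) m" for q m
      by (induction m) auto
    have "rank_step (str_to_nat (b # x), v) = (str_to_nat x, 2 * v + of_bool b)"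
      using step(2,3)[of "str_to_nat x" v] by simp
    then show ?case unfolding length_Cons shift by (simp only: Cons) (simp add: algebra_simps)
  qed simp
  from this[of "nat_to_str n" 0 for n] have "rank = (\<lambda>n. snd (rec_nat (n, 0) (\<lambda>_. rank_step) (len n)))"
    by (auto simp: rank_def len_def)
  moreover have ex: "\<exists>i. a \<le> 2 * i + 2" for a :: nat
    by (rule exI[of _ a]) simp
  have "tcomp (\<lambda>n. snd (rec_nat (n, 0) (\<lambda>_. rank_step) (len n)))"
    unfolding rank_step_def by (intro tc ex)
  ultimately show "tcomp rank" by simp
qed

section \<open>Machines and algorithms as partial functions on numbers\<close>

definition sfun :: "(nat \<Rightarrow> nat option) \<Rightarrow> bstr \<Rightarrow> bstr option" where
  "sfun u x = map_option nat_to_str (u (str_to_nat x))"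

lemma sfun_eq_Some_iff: "sfun u x = Some y \<longleftrightarrow> u (str_to_nat x) = Some (str_to_nat y)"
  by (auto simp: sfun_def)

lemma computable_iff: "computable U \<longleftrightarrow> (\<exists>e. U = sfun (phi e))"
proof
  assume "computable U"
  then obtain r where r: "\<And>x y. rec_eval r [str_to_nat x] y \<longleftrightarrow> U x = Some (nat_to_str y)"
    unfolding computable_def by blast
  have "phi (code r) = (\<lambda>n. map_option str_to_nat (U (nat_to_str n)))"
  proof (rule phi_code)
    fix n y
    show "rec_eval r [n] y \<longleftrightarrow> map_option str_to_nat (U (nat_to_str n)) = Some y"
      using r[of "nat_to_str n" y] by auto
  qed
  then have "U = sfun (phi (code r))"
    by (auto simp: sfun_def fun_eq_iff option.map_comp o_def option.map_ident)
  then show "\<exists>e. U = sfun (phi e)" ..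
next
  assume "\<exists>e. U = sfun (phi e)"
  then obtain e where U: "U = sfun (phi e)" ..
  obtain r where "\<And>x y. rec_eval r [x] y \<longleftrightarrow> phi e x = Some y" using ex_rec_eval_phi by blast
  then show "computable U" unfolding computable_def U sfun_eq_Some_iff by auto
qed

lemma computable_phi [simp]: "computable (sfun (phi e))"
  using computable_iff by blast

lemma all_computable_iff: "(\<forall>V. computable V \<longrightarrow> P V) \<longleftrightarrow> (\<forall>e. P (sfun (phi e)))"
  using computable_iff by auto

lemma C_le_iff: "C V x \<le> enat n \<longleftrightarrow> (\<exists>p. length p \<le> n \<and> V p = Some x)"
proof (cases "\<exists>p. V p = Some x")
  case True
  then have ex: "\<exists>n p. length p = n \<and> V p = Some x" by blast
  have "(LEAST n. \<exists>p. length p = n \<and> V p = Some x) \<le> n \<longleftrightarrow> (\<exists>p. length p \<le> n \<and> V p = Some x)"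
    using LeastI_ex[OF ex] Least_le[of "\<lambda>n. \<exists>p. length p = n \<and> V p = Some x"] order_trans by metis
  with True show ?thesis by (simp add: C_def)
next
  case False
  then show ?thesis by (auto simp: C_def)
qed

lemma optimal_iff:
  "optimal (sfun u) \<longleftrightarrow>
     (\<forall>e. \<exists>c. \<forall>p y. phi e p = Some y \<longrightarrow> (\<exists>q. len q \<le> len p + c \<and> u q = Some y))"
proof -
  have "(\<forall>x. C U x \<le> C V x + enat c) \<longleftrightarrow>
    (\<forall>p x. V p = Some x \<longrightarrow> (\<exists>q. length q \<le> length p + c \<and> U q = Some x))" for U V c
  proof (intro iffI allI impI)
    fix p x assume *: "\<forall>x. C U x \<le> C V x + enat c" "V p = Some x"
    then have "C V x \<le> enat (length p)" unfolding C_le_iff by blast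
    then have "C V x + enat c \<le> enat (length p + c)" by (metis add_right_mono plus_enat_simps(1))
    with * have "C U x \<le> enat (length p + c)" using order_trans by blast
    then show "\<exists>q. length q \<le> length p + c \<and> U q = Some x" unfolding C_le_iff .
  next
    fix x assume *: "\<forall>p x. V p = Some x \<longrightarrow> (\<exists>q. length q \<le> length p + c \<and> U q = Some x)"
    show "C U x \<le> C V x + enat c"
    proof (cases "C V x")
      case (enat n)
      then obtain p where "length p \<le> n" "V p = Some x" using C_le_iff[of V x n] by auto
      with * obtain q where "length q \<le> n + c" "U q = Some x" using add_right_mono order_trans by metis
      then show ?thesis using enat C_le_iff[of U x "n + c"] by auto
    qed simp
  qed
  moreover have "(\<forall>p x. sfun v p = Some x \<longrightarrow> (\<exists>q. length q \<le> length p + c \<and> sfun u q = Some x)) \<longleftrightarrow>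
    (\<forall>p y. v p = Some y \<longrightarrow> (\<exists>q. len q \<le> len p + c \<and> u q = Some y))" for v c
    unfolding sfun_eq_Some_iff len_def by (metis str_to_nat_nat_to_str nat_to_str_str_to_nat)
  ultimately show ?thesis
    unfolding optimal_def all_computable_iff by simp
qed

lemma computable_total_iff:
  "computable (\<lambda>x. Some (h x)) \<longleftrightarrow> tcomp (\<lambda>n. str_to_nat (h (nat_to_str n)))"
proof
  assume "computable (\<lambda>x. Some (h x))"
  then obtain e where e: "(\<lambda>x. Some (h x)) = sfun (phi e)" unfolding computable_iff by blast
  show "tcomp (\<lambda>n. str_to_nat (h (nat_to_str n)))"
  proof (rule tcomp_phi_total)
    fix n
    from fun_cong[OF e, of "nat_to_str n"] have "sfun (phi e) (nat_to_str n) = Some (h (nat_to_str n))" by simp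
    then show "phi e n = Some (str_to_nat (h (nat_to_str n)))" by (simp add: sfun_eq_Some_iff)
  qed
next
  assume "tcomp (\<lambda>n. str_to_nat (h (nat_to_str n)))"
  then obtain e where e: "\<And>n. phi e n = Some (str_to_nat (h (nat_to_str n)))" using ex_phi_total by blast
  have "(\<lambda>x. Some (h x)) = sfun (phi e)" by (simp add: fun_eq_iff sfun_def e)
  then show "computable (\<lambda>x. Some (h x))" unfolding computable_iff ..
qed

lemma ex_ex_cong: "(\<And>c. (\<exists>h. P h c) \<longleftrightarrow> (\<exists>h. Q h c)) \<Longrightarrow> (\<exists>h c. P h c) \<longleftrightarrow> (\<exists>h c. Q h c)"
  by blast

lemma effectively_optimal_iff:
  "effectively_optimal (sfun u) \<longleftrightarrow>
     (\<forall>e. \<exists>h c. tcomp h \<and> (\<forall>x. len (h x) \<le> len x + c) \<and> (\<forall>x. phi e x = u (h x)))"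
proof -
  have "(\<exists>h. computable (\<lambda>x. Some (h x)) \<and> (\<forall>x. length (h x) \<le> length x + c) \<and> (\<forall>x. sfun v x = sfun u (h x)))
    \<longleftrightarrow> (\<exists>h. tcomp h \<and> (\<forall>x. len (h x) \<le> len x + c) \<and> (\<forall>x. v x = u (h x)))" for v c
  proof
    assume "\<exists>h. computable (\<lambda>x. Some (h x)) \<and> (\<forall>x. length (h x) \<le> length x + c) \<and> (\<forall>x. sfun v x = sfun u (h x))"
    then obtain h where h: "tcomp (\<lambda>n. str_to_nat (h (nat_to_str n)))" "\<And>x. length (h x) \<le> length x + c"
      "\<And>x. sfun v x = sfun u (h x)" unfolding computable_total_iff by blast
    have "v n = u (str_to_nat (h (nat_to_str n)))" for n
      using h(3)[of "nat_to_str n"] by (auto simp: sfun_def dest!: injD[OF option.inj_map, rotated] intro!: injI)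
    with h show "\<exists>h. tcomp h \<and> (\<forall>x. len (h x) \<le> len x + c) \<and> (\<forall>x. v x = u (h x))"
      by (intro exI[of _ "\<lambda>n. str_to_nat (h (nat_to_str n))"]) (simp add: len_def)
  next
    assume "\<exists>h. tcomp h \<and> (\<forall>x. len (h x) \<le> len x + c) \<and> (\<forall>x. v x = u (h x))"
    then obtain h where "tcomp h" "\<And>x. len (h x) \<le> len x + c" "\<And>x. v x = u (h x)" by blast
    then show "\<exists>h. computable (\<lambda>x. Some (h x)) \<and> (\<forall>x. length (h x) \<le> length x + c) \<and> (\<forall>x. sfun v x = sfun u (h x))"
      by (intro exI[of _ "\<lambda>x. nat_to_str (h (str_to_nat x))"])
        (simp add: computable_total_iff sfun_def flip: len_str_to_nat)
  qed
  then show ?thesis unfolding effectively_optimal_def all_computable_iff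
    by (intro all_cong1 ex_ex_cong)
qed

lemma left_total_iff:
  "left_total (sfun u) \<longleftrightarrow> (\<forall>x y. len y = len x \<longrightarrow> rank y \<le> rank x \<longrightarrow> u x \<noteq> None \<longrightarrow> u y \<noteq> None)"
proof -
  have "left_total (sfun u) \<longleftrightarrow> (\<forall>x y. length y = length x \<longrightarrow> lex_rank y \<le> lex_rank x \<longrightarrow>
      u (str_to_nat x) \<noteq> None \<longrightarrow> u (str_to_nat y) \<noteq> None)"
    unfolding left_total_def by (auto simp: lex_le_iff sfun_def dom_def) (metis lex_le_iff option.distinct(1))+
  also have "\<dots> \<longleftrightarrow> (\<forall>x y. len y = len x \<longrightarrow> rank y \<le> rank x \<longrightarrow> u x \<noteq> None \<longrightarrow> u y \<noteq> None)"
    unfolding len_def rank_def by (metis str_to_nat_nat_to_str nat_to_str_str_to_nat)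
  finally show ?thesis .
qed

text \<open>The answers \<open>[True]\<close> and \<open>[False]\<close> have the numbers 2 and 1.\<close>

definition nerr :: "(nat \<Rightarrow> nat option) \<Rightarrow> (nat \<Rightarrow> nat option) \<Rightarrow> nat \<Rightarrow> bool" where
  "nerr u a k \<longleftrightarrow> (u k \<noteq> None \<and> a k \<noteq> Some 2) \<or> (u k = None \<and> a k \<noteq> Some 1)"

lemma sfun_answer: "sfun a x = Some [True] \<longleftrightarrow> a (str_to_nat x) = Some 2"
  "sfun a x = Some [False] \<longleftrightarrow> a (str_to_nat x) = Some 1" "sfun a x = None \<longleftrightarrow> a (str_to_nat x) = None"
  "x \<in> dom (sfun a) \<longleftrightarrow> a (str_to_nat x) \<noteq> None"
  by (simp_all add: sfun_eq_Some_iff) (auto simp: sfun_def)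

lemma card_length_le: "card {x. length x \<le> n \<and> P (str_to_nat x)} = card {k. k < strs n \<and> P k}"
proof (rule bij_betw_same_card)
  show "bij_betw str_to_nat {x. length x \<le> n \<and> P (str_to_nat x)} {k. k < strs n \<and> P k}"
    by (rule bij_betw_byWitness[where f' = nat_to_str]) (auto simp: less_strs_iff len_def)
qed

lemma err_frac_eq: "err_frac (sfun u) (sfun a) n = real (card {k. k < strs n \<and> nerr u a k}) / real (strs n)"
  using card_length_le[of n "nerr u a"] card_length_le[of n "\<lambda>_. True"]
  by (simp add: err_frac_def errs_def nerr_def sfun_answer)

definition sound :: "(nat \<Rightarrow> nat option) \<Rightarrow> (nat \<Rightarrow> nat option) \<Rightarrow> bool" where
  "sound u a \<longleftrightarrow> (\<forall>x. a x = None \<or> (a x = Some 2 \<and> u x \<noteq> None) \<or> (a x = Some 1 \<and> u x = None))"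

lemma never_wrong_iff: "never_wrong (sfun u) (sfun a) \<longleftrightarrow> sound u a"
  unfolding never_wrong_def sound_def sfun_answer by (metis str_to_nat_nat_to_str)

lemma approx_never_wrong_iff:
  "approx_never_wrong (sfun u) \<longleftrightarrow>
     (\<forall>\<epsilon>>0. \<exists>e. sound u (phi e) \<and> E_lower (sfun u) (sfun (phi e)) \<le> ereal \<epsilon>)"
  unfolding approx_never_wrong_def computable_iff
  by (metis never_wrong_iff)

section \<open>Effectively optimal machines\<close>

text \<open>For a function given by its graph alone, uniqueness of the output is all that remains to
  be checked; the \<open>SOME\<close> picks that output.\<close>

lemma ex_phi_rel:
  fixes P :: "nat \<Rightarrow> nat \<Rightarrow> 's::enc \<Rightarrow> bool"
  assumes "decid (\<lambda>z. P (fst z) (fst (snd z)) (snd (snd z)))"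
    and det: "\<And>x y y' s s'. P x y s \<Longrightarrow> P x y' s' \<Longrightarrow> y = y'"
  shows "\<exists>e. \<forall>x y. phi e x = Some y \<longleftrightarrow> (\<exists>s. P x y s)"
proof -
  define v where "v x = (if \<exists>y s. P x y s then Some (SOME y. \<exists>s. P x y s) else None)" for x
  have v: "v x = Some y \<longleftrightarrow> (\<exists>s. P x y s)" for x y
  proof
    assume *: "v x = Some y"
    then have ex: "\<exists>y s. P x y s" by (auto simp: v_def split: if_splits)
    with * show "\<exists>s. P x y s" using someI_ex[OF ex] by (simp add: v_def)
  next
    assume "\<exists>s. P x y s"
    then have "\<exists>s. P x (SOME y. \<exists>s. P x y s) s" by (rule someI)
    then have "(SOME y. \<exists>s. P x y s) = y" using det \<open>\<exists>s. P x y s\<close> by blast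
    then show "v x = Some y" using \<open>\<exists>s. P x y s\<close> by (auto simp: v_def)
  qed
  obtain e where "phi e = v" using ex_phi_graph[OF assms(1) v] by blast
  with v show ?thesis by blast
qed

lemma runs_det: "runs s e x y \<Longrightarrow> runs s' e x y' \<Longrightarrow> y = y'"
  by (metis runs_phi option.inject)

text \<open>The machine that reads \<open>e\<close> ones, a zero and \<open>p\<close>, and then runs
  \<open>phi e\<close> on \<open>p\<close>: the translation \<open>pad e\<close> is computable and
  adds \<open>e + 1\<close> bits.\<close>

lemma ex_effectively_optimal: "\<exists>u. effectively_optimal (sfun (phi u))"
proof -
  have "\<exists>u. \<forall>x y. phi u x = Some y \<longleftrightarrow>
    (\<exists>t. x = pad (fst t) (fst (snd t)) \<and> runs (snd (snd t)) (fst t) (fst (snd t)) y)"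
    by (rule ex_phi_rel) (intro tc, auto dest: runs_det)
  then obtain u where u: "\<And>x y. phi u x = Some y \<longleftrightarrow>
    (\<exists>t. x = pad (fst t) (fst (snd t)) \<and> runs (snd (snd t)) (fst t) (fst (snd t)) y)"
    by blast
  have "phi u (pad e p) = phi e p" for e p
  proof -
    have "phi u (pad e p) = Some y \<longleftrightarrow> phi e p = Some y" for y
      unfolding u phi_eq_Some_iff[of e] by auto
    then show ?thesis by (metis not_None_eq)
  qed
  then have "tcomp (pad e) \<and> (\<forall>x. len (pad e x) \<le> len x + (e + 1)) \<and> (\<forall>x. phi e x = phi u (pad e x))" for e
    by (auto intro: tcomp_pad[OF tcomp_const tcomp_id])
  then show ?thesis unfolding effectively_optimal_iff by blast
qed

lemma effectively_optimal_imp_optimal: "effectively_optimal (sfun u) \<Longrightarrow> optimal (sfun u)"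
  unfolding effectively_optimal_iff optimal_iff by metis

lemma len_eq_iff: "len p = m \<longleftrightarrow> p \<in> {2 ^ m - 1..<2 ^ m - 1 + 2 ^ m}"
proof -
  have "len p = m \<longleftrightarrow> len p \<le> m \<and> \<not> len p < m" by auto
  also have "\<not> len p < m \<longleftrightarrow> 2 ^ m - 1 \<le> p"
    using less_strs_iff[of p "m - 1"] by (cases m) (auto simp: strs_def)
  also have "len p \<le> m \<longleftrightarrow> p < 2 ^ m - 1 + 2 ^ m"
    using less_strs_iff[of p m] by (auto simp: strs_def)
  finally show ?thesis by auto
qed

lemma finite_len [simp]: "finite {p. len p = m}"
  and card_len [simp]: "card {p. len p = m} = 2 ^ m"
  unfolding len_eq_iff Collect_mem_eq card_atLeastLessThan by auto

lemma E_lower_ge: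
  assumes "\<And>n. N \<le> n \<Longrightarrow> \<delta> \<le> err_frac U A n" shows "ereal \<delta> \<le> E_lower U A"
  unfolding E_lower_def
  by (rule Liminf_bounded) (use assms in \<open>auto simp: eventually_sequentially\<close>)

text \<open>Feeding the universal machine its own index lets a program with index \<open>r\<close> know the function
  \<open>p \<mapsto> h (pad r p)\<close> that translates the slice \<open>r\<close> into inputs of \<open>u\<close>.  This program spends at most
  one string of length \<open>m\<close> on each of the first \<open>m\<close> algorithms to refute it, and punishes a
  collision of \<open>h\<close> by treating its members differently.\<close>

lemma effectively_optimal_slice:
  assumes "effectively_optimal (sfun (phi u))"
  shows "\<exists>G d. (\<forall>p. len (G p) \<le> len p + d) \<and> (\<forall>m. inj_on G {p. len p = m}) \<and>
    (\<forall>m j. sound (phi u) (phi j) \<longrightarrow> j < m \<longrightarrow> card {p. len p = m \<and> phi j (G p) \<noteq> None} \<le> m)"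
proof -
  \<comment> \<open>Program \<open>i\<close> is run on the whole input \<open>pad i p\<close>, not
    on \<open>p\<close>. Thus \<open>h\<close>, obtained for this one machine, serves all slices,
    and a program may use \<open>h\<close> on its own slice although its index is fixed
    later.\<close>
  have "\<exists>w. \<forall>x y. phi w x = Some y \<longleftrightarrow>
    (\<exists>t. x = pad (fst t) (fst (snd t)) \<and> runs (snd (snd t)) (fst t) x y)"
    by (rule ex_phi_rel) (intro tc, auto dest: runs_det)
  then obtain w where w: "\<And>x y. phi w x = Some y \<longleftrightarrow>
    (\<exists>t. x = pad (fst t) (fst (snd t)) \<and> runs (snd (snd t)) (fst t) x y)"
    by blast
  obtain h c where h: "tcomp h" "\<And>x. len (h x) \<le> len x + c" "\<And>x. phi w x = phi u (h x)"
    using assms unfolding effectively_optimal_iff by blast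
  have [tc]: "tcomp f \<Longrightarrow> tcomp (\<lambda>z. h (f z))" for f :: "'z::enc \<Rightarrow> nat"
    by (rule tcomp_comp[OF h(1)])
  define coll where "coll i m \<longleftrightarrow> (\<exists>p<strs m. \<exists>q<p. len p = m \<and> len q = m \<and> h (pad i p) = h (pad i q))" for i m
  define no where "no i m j t \<longleftrightarrow> len (psnd t) = m \<and> runs (pfst t) j (h (pad i (psnd t))) 1" for i m j t
  \<comment> \<open>On a length with a collision, exactly those strings halt that are not the first
    with their image. On other lengths, for each \<open>j\<close> below the length, the string in
    the first pair (stage, string) at which algorithm \<open>j\<close> answers 0 (the number
    \<open>1\<close>) on the image is made to halt.\<close>
  define R where "R i p j t \<longleftrightarrow> (coll i (len p) \<and> (\<exists>q<p. len q = len p \<and> h (pad i q) = h (pad i p))) \<or>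
      (\<not> coll i (len p) \<and> j < len p \<and> no i (len p) j t \<and> (\<forall>t'<t. \<not> no i (len p) j t') \<and> p = psnd t)"
    for i p j t
  have "\<exists>e. \<forall>x y. phi e x = Some y \<longleftrightarrow> (\<exists>s. x = pad (fst s) (fst (snd s)) \<and> y = 0 \<and>
      R (fst s) (fst (snd s)) (fst (snd (snd s))) (snd (snd (snd s))))"
    by (rule ex_phi_rel) (unfold R_def coll_def no_def, intro tc, blast)
  then obtain r where r: "\<And>x y. phi r x = Some y \<longleftrightarrow> (\<exists>s. x = pad (fst s) (fst (snd s)) \<and> y = 0 \<and>
      R (fst s) (fst (snd s)) (fst (snd (snd s))) (snd (snd (snd s))))" by blast
  define G where "G p = h (pad r p)" for p
  have "phi w (pad r p) = phi r (pad r p)" for p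
  proof -
    have "phi w (pad r p) = Some y \<longleftrightarrow> phi r (pad r p) = Some y" for y
      unfolding w phi_eq_Some_iff[of r] by auto
    then show ?thesis by (metis not_None_eq)
  qed
  then have "phi u (G p) = phi r (pad r p)" for p
    using h(3) by (simp add: G_def)
  then have halt: "phi u (G p) \<noteq> None \<longleftrightarrow> (\<exists>j t. R r p j t)" for p
    using r[of "pad r p"] by auto
  \<comment> \<open>The first member \<open>p0\<close> of a collision class diverges while a later
    member \<open>p\<close> halts, but \<open>u\<close> receives the same input for both.\<close>
  have nocoll: "\<not> coll r m" for m
  proof
    assume coll: "coll r m"
    then obtain p q where pq: "q < p" "len p = m" "len q = m" "G p = G q"
      unfolding coll_def G_def by blast
    define p0 where "p0 = (LEAST p'. len p' = m \<and> G p' = G p)"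
    have p0: "len p0 = m" "G p0 = G p"
      unfolding p0_def using LeastI[of "\<lambda>p'. len p' = m \<and> G p' = G p" p] pq by simp_all
    have "\<not> (q < p0 \<and> len q = m \<and> G q = G p)" for q
      unfolding p0_def using not_less_Least[of q "\<lambda>p'. len p' = m \<and> G p' = G p"] by blast
    then have "\<not> R r p0 j t" for j t
      using coll p0 unfolding R_def by (auto simp flip: G_def)
    moreover have "R r p j t" for j t
      using coll pq unfolding R_def by (auto simp flip: G_def)
    ultimately show False using halt[of p] halt[of p0] p0(2) by simp
  qed
  show ?thesis
  proof (intro exI conjI allI impI)
    show "len (G p) \<le> len p + (r + 1 + c)" for p
      using h(2)[of "pad r p"] by (simp add: G_def)
    show "inj_on G {p. len p = m}" for m
    proof (rule linorder_inj_onI')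
      fix p q assume "p \<in> {p. len p = m}" "q \<in> {p. len p = m}" "p < q"
      then show "G p \<noteq> G q"
        using nocoll[of m] less_strs_iff[of q m] unfolding coll_def G_def by (metis mem_Collect_eq order_refl)
    qed
    fix m j assume sound: "sound (phi u) (phi j)" and j: "j < m"
    \<comment> \<open>A sound algorithm \<open>j < m\<close> never answers 0 on this slice, as its
      first such answer would have been refuted. So it answers only where \<open>u\<close> halts,
      and each \<open>j' < m\<close> makes at most one string of length \<open>m\<close>
      halt.\<close>
    have "{p. len p = m \<and> phi j (G p) \<noteq> None} \<subseteq> (\<lambda>j. psnd (LEAST t. no r m j t)) ` {..<m}"
    proof clarify
      fix p y assume m: "m = len p" and y: "phi j (G p) = Some y"
      have "\<not> (\<exists>t. no r m j t)"
      proof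
        assume ex: "\<exists>t. no r m j t"
        define t where "t = (LEAST t. no r m j t)"
        have t: "no r m j t" "\<forall>t'<t. \<not> no r m j t'"
          unfolding t_def using LeastI_ex[OF ex] not_less_Least by blast+
        then have "R r (psnd t) j t"
          using nocoll j unfolding R_def no_def by auto
        then have "phi u (G (psnd t)) \<noteq> None" using halt by blast
        moreover have "phi j (G (psnd t)) = Some 1"
          using t(1) runs_phi unfolding no_def G_def by blast
        ultimately show False using sound unfolding sound_def by (metis one_eq_numeral_iff option.inject semiring_norm(83) option.distinct(1))
      qed
      have "y \<noteq> 1"
      proof
        assume "y = 1"
        with y obtain s where "runs s j (G p) 1" using phi_eq_Some_iff by blast
        then have "no r m j (prod_encode (s, p))" using m by (simp add: no_def G_def)
        with \<open>\<not> (\<exists>t. no r m j t)\<close> show False by blast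
      qed
      with y sound have "phi u (G p) \<noteq> None" unfolding sound_def by (metis option.distinct(1) option.inject)
      then obtain j' t where "R r p j' t" using halt by blast
      then have t: "j' < m" "no r m j' t" "\<forall>t'<t. \<not> no r m j' t'" "p = psnd t"
        using nocoll m unfolding R_def by auto
      then have "(LEAST t. no r m j' t) = t" by (metis LeastI not_less_Least linorder_neqE_nat)
      with t show "p \<in> (\<lambda>j. psnd (LEAST t. no r (len p) j t)) ` {..<len p}" using m by (auto intro!: image_eqI[of _ _ j'])
    qed
    then have "card {p. len p = m \<and> phi j (G p) \<noteq> None} \<le> card ((\<lambda>j. psnd (LEAST t. no r m j t)) ` {..<m})"
      by (intro card_mono) auto
    also have "\<dots> \<le> m" using card_image_le[of "{..<m}"] by simp
    finally show "card {p. len p = m \<and> phi j (G p) \<noteq> None} \<le> m" .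
  qed
qed

lemma two_mult_le_power: "2 * m \<le> 2 ^ m" for m :: nat
proof (induction m)
  case (Suc m)
  then show ?case by (cases m) auto
qed simp

lemma effectively_optimal_not_approx:
  assumes "effectively_optimal (sfun (phi u))"
  shows "\<not> approx_never_wrong (sfun (phi u))"
proof -
  obtain G d where G: "\<And>p. len (G p) \<le> len p + d" "\<And>m. inj_on G {p. len p = m}"
    "\<And>m j. sound (phi u) (phi j) \<Longrightarrow> j < m \<Longrightarrow> card {p. len p = m \<and> phi j (G p) \<noteq> None} \<le> m"
    using effectively_optimal_slice[OF assms] by blast
  \<comment> \<open>With \<open>n = m + d\<close>, at least \<open>2 ^ m - m\<close>, hence at least
    \<open>2 ^ m / 2\<close>, strings of length \<open>m\<close> have distinct images of length at
    most \<open>n\<close> without an answer, out of at most \<open>2 ^ (m + d + 1)\<close> strings.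
    The bound does not depend on \<open>j\<close>; only the start \<open>m > j\<close> does.\<close>
  define \<delta> :: real where "\<delta> = 1 / 2 ^ (d + 2)"
  have "ereal \<delta> \<le> E_lower (sfun (phi u)) (sfun (phi j))" if sound: "sound (phi u) (phi j)" for j
  proof (rule E_lower_ge)
    fix n assume n: "j + d + 1 \<le> n"
    define m where "m = n - d"
    have m: "j < m" "n = m + d" using n by (auto simp: m_def)
    let ?E = "{k. k < strs n \<and> nerr (phi u) (phi j) k}"
    let ?S = "{p. len p = m \<and> phi j (G p) = None}"
    let ?T = "{p. len p = m \<and> phi j (G p) \<noteq> None}"
    have "?S \<union> ?T = {p. len p = m}" by auto
    then have "card (?S \<union> ?T) = 2 ^ m" by (simp only: card_len)
    then have "2 ^ m \<le> card ?S + m"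
      using card_Un_le[of ?S ?T] G(3)[OF sound m(1)] by linarith
    moreover have "card ?S \<le> card ?E"
    proof (rule card_inj_on_le)
      show "inj_on G ?S" by (rule inj_on_subset[OF G(2)[of m]]) auto
      show "G ` ?S \<subseteq> ?E"
      proof clarify
        fix p assume p: "m = len p" "phi j (G p) = None"
        have "len (G p) \<le> n" using G(1)[of p] p(1) m(2) by simp
        then show "G p < strs n \<and> nerr (phi u) (phi j) (G p)"
          using p(2) by (auto simp: less_strs_iff nerr_def)
      qed
    qed simp
    ultimately have "2 ^ m \<le> 2 * card ?E" using two_mult_le_power[of m] by linarith
    then have "real (2 ^ m) \<le> real (2 * card ?E)" by (rule of_nat_mono)
    then have 1: "2 ^ m / 2 \<le> real (card ?E)" by simp
    have "real (strs n) \<le> real (2 ^ Suc n)" using strs_le by (rule of_nat_mono)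
    then have 2: "real (strs n) \<le> 2 ^ m * 2 ^ (d + 1)" by (simp add: m(2) power_add)
    have pos: "0 < real (strs n)" using strs_pos[of n] by (simp add: less_le_trans[of 0 "2 ^ n"])
    have "\<delta> * real (strs n) \<le> \<delta> * (2 ^ m * 2 ^ (d + 1))"
      by (rule mult_left_mono[OF 2]) (simp add: \<delta>_def)
    also have "\<dots> = 2 ^ m / 2" by (simp add: \<delta>_def power_add)
    finally show "\<delta> \<le> err_frac (sfun (phi u)) (sfun (phi j)) n"
      unfolding err_frac_eq using 1 pos by (simp add: pos_le_divide_eq)
  qed
  note lower = this
  have \<delta>: "0 < \<delta>" by (simp add: \<delta>_def)
  show ?thesis
  proof
    assume "approx_never_wrong (sfun (phi u))"
    then obtain j where "sound (phi u) (phi j)" "E_lower (sfun (phi u)) (sfun (phi j)) \<le> ereal (\<delta> / 2)"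
      unfolding approx_never_wrong_iff using \<delta> half_gt_zero by blast
    with order_trans[OF lower] have "ereal \<delta> \<le> ereal (\<delta> / 2)" by blast
    with \<delta> show False by simp
  qed
qed

section \<open>Left-total machines\<close>

text \<open>\<open>w\<close> codes a stage and a string that halts exactly between this stage and
  the next. Each halting string has one event, and counting smaller event codes gives a computable
  order of appearance.\<close>

definition halt_event :: "nat \<Rightarrow> nat \<Rightarrow> nat \<Rightarrow> bool" where
  "halt_event u n w \<longleftrightarrow> len (psnd w) = n \<and> halts (Suc (pfst w)) u (psnd w) \<and> \<not> halts (pfst w) u (psnd w)"

definition event_index :: "nat \<Rightarrow> nat \<Rightarrow> nat \<Rightarrow> nat" where
  "event_index u n w = card {v. v < w \<and> halt_event u n v}"

lemma event_index_Suc: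
  "event_index u n (Suc w) = event_index u n w + of_bool (halt_event u n w)"
proof -
  have "{v. v < Suc w \<and> halt_event u n v} =
    (if halt_event u n w then insert w else id) {v. v < w \<and> halt_event u n v}"
    by (auto simp: less_Suc_eq)
  then show ?thesis by (simp add: event_index_def)
qed

lemma event_index_mono: "v \<le> w \<Longrightarrow> event_index u n v \<le> event_index u n w"
  unfolding event_index_def by (rule card_mono) auto

lemma event_index_inj:
  assumes "halt_event u n v" "halt_event u n w" "event_index u n v = event_index u n w"
  shows "v = w"
proof -
  have "\<not> v < w" if "halt_event u n v" "event_index u n v = event_index u n w" for v w
    using that event_index_Suc[of u n v] event_index_mono[of "Suc v" w u n] by auto
  with assms show ?thesis by (metis linorder_neqE_nat)
qed

text \<open>Indices are given out without gaps; this makes the domain of the new machine an initial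
  segment.\<close>

lemma ex_event_index: "r < event_index u n w \<Longrightarrow> \<exists>v. halt_event u n v \<and> event_index u n v = r"
proof (induction w)
  case 0
  then show ?case by (simp add: event_index_def)
next
  case (Suc w)
  show ?case
  proof (cases "r < event_index u n w")
    case True
    then show ?thesis by (rule Suc.IH)
  next
    case False
    with Suc.prems have "halt_event u n w" "event_index u n w = r"
      by (cases "halt_event u n w"; simp add: event_index_Suc)+
    then show ?thesis by blast
  qed
qed

text \<open>Events of one length belong to distinct strings, so every index is the rank of some
  string of that length.\<close>

lemma event_index_less:
  assumes "halt_event u n w" shows "event_index u n w < 2 ^ n"
proof -
  have "inj_on psnd {v. v < Suc w \<and> halt_event u n v}"
  proof (rule inj_onI)
    fix v v' assume *: "v \<in> {v. v < Suc w \<and> halt_event u n v}" "v' \<in> {v. v < Suc w \<and> halt_event u n v}"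
      and eq: "psnd v = psnd v'"
    have "\<not> pfst v < pfst v'" if "halt_event u n v" "halt_event u n v'" "psnd v = psnd v'" for v v'
      using that halts_mono[of "Suc (pfst v)" u "psnd v" "pfst v'"] unfolding halt_event_def by auto
    with * eq have "pfst v = pfst v'" by (metis (no_types, lifting) linorder_neqE_nat mem_Collect_eq)
    with eq show "v = v'" by (metis prod_decode_eq prod_eqI)
  qed
  then have "event_index u n (Suc w) \<le> card {p. len p = n}"
    unfolding event_index_def by (rule card_inj_on_le) (auto simp: halt_event_def)
  with assms show ?thesis by (simp add: event_index_Suc)
qed

text \<open>A string \<open>x\<close> receives the output of the event with index
  \<open>rank x\<close> among the events of its length. Programs are only permuted within their
  length, so complexities do not increase.\<close>

lemma ex_left_total_optimal:
  assumes "optimal (sfun (phi u))"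
  shows "\<exists>v. optimal (sfun (phi v)) \<and> left_total (sfun (phi v))"
proof -
  have "\<exists>v. \<forall>x y. phi v x = Some y \<longleftrightarrow> (\<exists>t. halt_event u (len x) (fst t) \<and>
    event_index u (len x) (fst t) = rank x \<and> runs (snd t) u (psnd (fst t)) y)"
  proof (rule ex_phi_rel)
    show "decid (\<lambda>z. halt_event u (len (fst z)) (fst (snd (snd z))) \<and>
      event_index u (len (fst z)) (fst (snd (snd z))) = rank (fst z) \<and>
      runs (snd (snd (snd z))) u (psnd (fst (snd (snd z)))) (fst (snd z)))"
      unfolding halt_event_def event_index_def by (intro tc)
  next
    fix x y y' and t t' :: "nat \<times> nat"
    assume *: "halt_event u (len x) (fst t) \<and> event_index u (len x) (fst t) = rank x \<and> runs (snd t) u (psnd (fst t)) y"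
      "halt_event u (len x) (fst t') \<and> event_index u (len x) (fst t') = rank x \<and> runs (snd t') u (psnd (fst t')) y'"
    then have "fst t = fst t'" using event_index_inj[of u "len x" "fst t" "fst t'"] by simp
    with * have "runs (snd t) u (psnd (fst t)) y" "runs (snd t') u (psnd (fst t)) y'" by simp_all
    then show "y = y'" by (rule runs_det)
  qed
  then obtain v where v: "\<And>x y. phi v x = Some y \<longleftrightarrow> (\<exists>t. halt_event u (len x) (fst t) \<and>
    event_index u (len x) (fst t) = rank x \<and> runs (snd t) u (psnd (fst t)) y)" by blast
  have dom: "phi v x \<noteq> None \<longleftrightarrow> (\<exists>w. halt_event u (len x) w \<and> event_index u (len x) w = rank x)" for x
  proof
    assume "phi v x \<noteq> None"
    then show "\<exists>w. halt_event u (len x) w \<and> event_index u (len x) w = rank x" using v by blast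
  next
    assume "\<exists>w. halt_event u (len x) w \<and> event_index u (len x) w = rank x"
    then obtain w where w: "halt_event u (len x) w" "event_index u (len x) w = rank x" by blast
    then obtain y where "runs (Suc (pfst w)) u (psnd w) y" unfolding halt_event_def halts_runs_iff by blast
    with w have "phi v x = Some y" unfolding v by (intro exI[of _ "(w, Suc (pfst w))"]) simp
    then show "phi v x \<noteq> None" by simp
  qed
  have "left_total (sfun (phi v))"
    unfolding left_total_iff
  proof (intro allI impI)
    fix x y assume len: "len y = len x" and rank: "rank y \<le> rank x" and "phi v x \<noteq> None"
    then obtain w where w: "halt_event u (len x) w" "event_index u (len x) w = rank x"
      unfolding dom by blast
    then have "rank y < event_index u (len x) (Suc w)" using rank by (simp add: event_index_Suc)
    from ex_event_index[OF this] show "phi v y \<noteq> None" unfolding dom len by blast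
  qed
  moreover have "optimal (sfun (phi v))"
    unfolding optimal_iff
  proof
    fix e
    obtain c where c: "\<And>p y. phi e p = Some y \<Longrightarrow> \<exists>q. len q \<le> len p + c \<and> phi u q = Some y"
      using assms unfolding optimal_iff by blast
    have "\<exists>x. len x \<le> len p + c \<and> phi v x = Some y" if "phi e p = Some y" for p y
    proof -
      from c[OF that] obtain q where q: "len q \<le> len p + c" "phi u q = Some y" by blast
      then obtain s' where s': "runs s' u q y" using phi_eq_Some_iff by blast
      then have ex: "\<exists>s. halts s u q" using halts_runs_iff by blast
      \<comment> \<open>The first halting stage of \<open>q\<close> is positive, since nothing halts
        at stage 0; its predecessor gives the event of \<open>q\<close>.\<close>
      define s where "s = (LEAST s. halts s u q)"
      have "halts s u q" unfolding s_def by (rule LeastI_ex[OF ex])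
      moreover have "\<not> halts 0 u q" by (simp add: halts_def)
      ultimately obtain s1 where s1: "s = Suc s1" by (cases s) auto
      then have "\<not> halts s1 u q" using not_less_Least[of s1 "\<lambda>s. halts s u q"] by (simp flip: s_def)
      with \<open>halts s u q\<close> s1 have w: "halt_event u (len q) (prod_encode (s1, q))" by (simp add: halt_event_def)
      from ex_lex_rank[OF event_index_less[OF w]]
      obtain x where "length x = len q" "lex_rank x = event_index u (len q) (prod_encode (s1, q))" by blast
      then have x: "len (str_to_nat x) = len q" "rank (str_to_nat x) = event_index u (len q) (prod_encode (s1, q))"
        by (simp_all add: rank_def)
      have "phi v (str_to_nat x) = Some y"
        unfolding v x using w s' by (intro exI[of _ "(prod_encode (s1, q), s')"]) simp
      with x q show ?thesis by metis
    qed
    then show "\<exists>c. \<forall>p y. phi e p = Some y \<longrightarrow> (\<exists>x. len x \<le> len p + c \<and> phi v x = Some y)" by blast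
  qed
  ultimately show ?thesis by blast
qed

section \<open>Small errors on infinitely many lengths\<close>

text \<open>The upper limit of a bounded sequence of integers: it is attained infinitely often and
  eventually never exceeded.\<close>

lemma ex_eventual_max:
  fixes f :: "nat \<Rightarrow> nat"
  assumes "\<And>t. f t \<le> M"
  shows "\<exists>a. (\<forall>N. \<exists>t\<ge>N. f t = a) \<and> (\<exists>N. \<forall>t\<ge>N. f t \<le> a)"
proof -
  let ?P = "\<lambda>a. \<exists>N. \<forall>t\<ge>N. f t \<le> a"
  have ex: "\<exists>a. ?P a" using assms by blast
  define a where "a = (LEAST a. ?P a)"
  have a: "?P a" unfolding a_def by (rule LeastI_ex[OF ex])
  then obtain N0 where N0: "\<And>t. N0 \<le> t \<Longrightarrow> f t \<le> a" by blast
  have "\<exists>t\<ge>N. f t = a" for N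
  proof (rule ccontr)
    assume "\<not> (\<exists>t\<ge>N. f t = a)"
    then have less: "f t < a" if "max N N0 \<le> t" for t using N0[of t] that by (simp add: nat_less_le)
    have "0 < a" by (rule le_less_trans[OF le0 less[OF order_refl]])
    with less have "?P (a - 1)" by (intro exI[of _ "max N N0"]) fastforce
    then have "a \<le> a - 1" unfolding a_def by (rule Least_le)
    with \<open>0 < a\<close> show False by simp
  qed
  with a show ?thesis by blast
qed

lemma E_lower_le:
  assumes "\<And>N. \<exists>n\<ge>N. err_frac U A n \<le> \<epsilon>" shows "E_lower U A \<le> ereal \<epsilon>"
proof (rule ccontr)
  assume "\<not> E_lower U A \<le> ereal \<epsilon>"
  then have "ereal \<epsilon> < liminf (\<lambda>n. ereal (err_frac U A n))" by (simp add: E_lower_def)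
  from less_LiminfD[OF this] obtain N where "\<And>n. N \<le> n \<Longrightarrow> \<epsilon> < err_frac U A n"
    by (auto simp: eventually_sequentially)
  with assms[of N] show False by (meson not_le)
qed

text \<open>Lengths are grouped into blocks of \<open>k\<close> consecutive lengths; \<open>blk k l\<close> is the last length of the
  block of \<open>l\<close>.  All but a fraction of about \<open>1 / 2 ^ k\<close> of the strings up to the end of a block have
  lengths in that block.\<close>

definition blk_no :: "nat \<Rightarrow> nat \<Rightarrow> nat" where "blk_no k l = (LEAST t. l < k * t)"

definition blk :: "nat \<Rightarrow> nat \<Rightarrow> nat" where "blk k l = k * blk_no k l - 1"

lemma blk_no_ex: "0 < k \<Longrightarrow> \<exists>t. l < k * t" for k :: nat
  by (rule exI[of _ "Suc l"]) (cases k, auto)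

lemma blk_no_unique:
  assumes "k * (t - 1) \<le> l" "l < k * t" shows "blk_no k l = t"
  unfolding blk_no_def
proof (rule Least_equality)
  fix t' assume "l < k * t'"
  then have "k * (t - 1) < k * t'" using assms by linarith
  then show "t \<le> t'" by auto
qed (rule assms)

lemma tcomp_blk_no: "0 < k \<Longrightarrow> tcomp f \<Longrightarrow> tcomp (\<lambda>z. blk_no k (f z))"
proof (erule tcomp_comp[rotated])
  assume "0 < k"
  then show "tcomp (blk_no k)" unfolding blk_no_def[abs_def] by (intro tc blk_no_ex)
qed

lemma tcomp_blk: "0 < k \<Longrightarrow> tcomp f \<Longrightarrow> tcomp (\<lambda>z. blk k (f z))"
  unfolding blk_def by (intro tc tcomp_blk_no)

section \<open>Densities of the domain at the ends of blocks\<close>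

definition halted :: "nat \<Rightarrow> nat \<Rightarrow> nat \<Rightarrow> nat" where
  "halted u n s = card {k. k < strs n \<and> halts s u k}"

definition halting :: "nat \<Rightarrow> nat \<Rightarrow> nat" where
  "halting u n = card {k. k < strs n \<and> phi u k \<noteq> None}"

lemma halting_diff:
  "halting u n = halted u n s + card {k. k < strs n \<and> phi u k \<noteq> None \<and> \<not> halts s u k}"
proof -
  let ?A = "{k. k < strs n \<and> halts s u k}" and ?B = "{k. k < strs n \<and> phi u k \<noteq> None \<and> \<not> halts s u k}"
  have "{k. k < strs n \<and> phi u k \<noteq> None} = ?A \<union> ?B" using phi_halts_iff by auto
  moreover have "card (?A \<union> ?B) = card ?A + card ?B" by (rule card_Un_disjoint) auto
  ultimately show ?thesis unfolding halting_def halted_def by simp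
qed

lemma ex_stage: "\<exists>s. \<forall>k<N. phi u k \<noteq> None \<longrightarrow> halts s u k"
proof (induction N)
  case (Suc N)
  then obtain s where s: "\<And>k. k < N \<Longrightarrow> phi u k \<noteq> None \<Longrightarrow> halts s u k" by blast
  show ?case
  proof (cases "phi u N = None")
    case False
    then obtain s' where "halts s' u N" using phi_halts_iff by blast
    with s have "\<forall>k<Suc N. phi u k \<noteq> None \<longrightarrow> halts (max s s') u k"
      using halts_mono[of _ u _ "max s s'"] by (metis less_Suc_eq max.cobounded1 max.cobounded2)
    then show ?thesis ..
  qed (use s in \<open>auto simp: less_Suc_eq\<close>)
qed simp

lemma ex_halted: "\<exists>s. halted u n s = halting u n"
proof -
  obtain s where "\<forall>k<strs n. phi u k \<noteq> None \<longrightarrow> halts s u k" using ex_stage by blast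
  then have "{k. k < strs n \<and> halts s u k} = {k. k < strs n \<and> phi u k \<noteq> None}"
    using phi_halts_iff by auto
  then have "halted u n s = halting u n" unfolding halted_def halting_def by (simp only:)
  then show ?thesis ..
qed

text \<open>\<open>density u k M t / M\<close> is the fraction of halting strings up to the end of
  block \<open>t\<close>, rounded down to a multiple of \<open>1 / M\<close>. Only finitely many
  values are possible, so one recurs and can be built into an algorithm.\<close>

definition density :: "nat \<Rightarrow> nat \<Rightarrow> nat \<Rightarrow> nat \<Rightarrow> nat" where
  "density u k M t = M * halting u (k * t - 1) div strs (k * t - 1)"

lemma strs_gt_0 [simp]: "0 < strs n"
  using strs_pos[of n] by (rule less_le_trans[rotated]) simp

lemma density_le: "density u k M t \<le> M"
proof -
  have "halting u n \<le> strs n" for n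
    unfolding halting_def using card_mono[of "{..<strs n}" "{k. k < strs n \<and> phi u k \<noteq> None}"] by auto
  then have "M * halting u (k * t - 1) \<le> M * strs (k * t - 1)" by (rule mult_le_mono2)
  then have "density u k M t \<le> M * strs (k * t - 1) div strs (k * t - 1)"
    unfolding density_def by (rule div_le_mono)
  then show ?thesis by simp
qed

lemma density_lower: "density u k M t * strs (k * t - 1) \<le> M * halting u (k * t - 1)"
  by (simp add: density_def)

lemma density_upper:
  assumes "density u k M t \<le> a" shows "M * halting u (k * t - 1) < (a + 1) * strs (k * t - 1)"
  using assms unfolding density_def by (metis Suc_eq_plus1 less_Suc_eq_le less_mult_imp_div_less[of _ _ _] div_less_iff_less_mult strs_gt_0)

text \<open>The rounded density leaves room for fewer than \<open>a + 1\<close> parts in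
  \<open>M\<close>; once \<open>a\<close> parts have halted, less than one part is still to
  come.\<close>

lemma late_halting:
  assumes "density u k M t \<le> a" "a * strs (k * t - 1) \<le> M * halted u (k * t - 1) s"
  shows "M * card {x. x < strs (k * t - 1) \<and> phi u x \<noteq> None \<and> \<not> halts s u x} < strs (k * t - 1)"
  using density_upper[OF assms(1)] assms(2) unfolding halting_diff[of u "k * t - 1" s]
  by (simp add: algebra_simps)

text \<open>Fewer than \<open>2 ^ (k * (t - 1))\<close> strings are shorter than the block, and up
  to length \<open>k * t - 1\<close> there are at least \<open>2 ^ (k * t - 1)\<close> strings; the
  quotient is the term \<open>2 / 2 ^ k\<close>.\<close>

lemma block_err_frac:
  assumes k: "0 < k" and t: "1 \<le> t"
    and E: "M * card {x. x < strs (k * t - 1) \<and> k * (t - 1) \<le> len x \<and> nerr u a x} \<le> b * strs (k * t - 1)"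
    and M: "0 < M"
  shows "err_frac (sfun u) (sfun a) (k * t - 1) \<le> b / M + 2 / 2 ^ k"
proof -
  define n where "n = k * t - 1"
  have n: "Suc n = k * (t - 1) + k" using k t by (cases t) (auto simp: n_def)
  let ?E = "{x. x < strs n \<and> k * (t - 1) \<le> len x \<and> nerr u a x}"
  have "{x. x < strs n \<and> nerr u a x} \<subseteq> ?E \<union> {..<2 ^ (k * (t - 1))}"
  proof
    fix x assume x: "x \<in> {x. x < strs n \<and> nerr u a x}"
    have "k * (t - 1) \<le> len x" if "\<not> x < 2 ^ (k * (t - 1))"
      using that less_strs_iff[of x "k * (t - 1) - 1"] by (cases "k * (t - 1)") (auto simp: strs_def)
    with x show "x \<in> ?E \<union> {..<2 ^ (k * (t - 1))}" by blast
  qed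
  then have "card {x. x < strs n \<and> nerr u a x} \<le> card (?E \<union> {..<2 ^ (k * (t - 1))})"
    by (rule card_mono[rotated]) simp
  also have "\<dots> \<le> card ?E + 2 ^ (k * (t - 1))"
    using card_Un_le[of ?E "{..<2 ^ (k * (t - 1))}"] by simp
  finally have "real (card {x. x < strs n \<and> nerr u a x}) \<le> real (card ?E + 2 ^ (k * (t - 1)))"
    by (rule of_nat_mono)
  then have 1: "real (card {x. x < strs n \<and> nerr u a x}) \<le> real (card ?E) + 2 ^ (k * (t - 1))" by simp
  have pos: "0 < real (strs n)" by simp
  have "real (M * card ?E) \<le> real (b * strs n)" using E unfolding n_def by (rule of_nat_mono)
  then have 2: "real (card ?E) \<le> b / M * strs n" using M by (simp add: field_simps)
  have "2 ^ n \<le> real (strs n)" using of_nat_mono[OF strs_pos[of n], where 'a = real] by simp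
  then have "2 ^ Suc n \<le> 2 * real (strs n)" by simp
  then have 3: "2 ^ (k * (t - 1)) \<le> 2 / 2 ^ k * real (strs n)"
    unfolding n power_add by (simp add: field_simps)
  from 1 2 3 have "real (card {x. x < strs n \<and> nerr u a x}) \<le> (b / M + 2 / 2 ^ k) * strs n"
    by (simp add: algebra_simps)
  then show ?thesis unfolding n_def[symmetric] err_frac_eq using pos by (simp add: pos_divide_le_eq)
qed

text \<open>With \<open>M = k * 2 ^ k\<close> the sum is \<open>3 / 2 ^ k\<close>. The factor
  \<open>k\<close> in \<open>k / M\<close> provides for the left-total case, where each of the
  \<open>k\<close> lengths of a block may lose a fraction \<open>1 / M\<close>.\<close>

lemma ex_block_size:
  assumes "0 < \<epsilon>" obtains k M :: nat where "0 < k" "0 < M" "real k / real M + 2 / 2 ^ k \<le> \<epsilon>"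
proof -
  obtain k where k: "3 / \<epsilon> < 2 ^ k" using real_arch_pow[of 2 "3 / \<epsilon>"] by auto
  then have "3 < \<epsilon> * 2 ^ k" using assms by (simp add: field_simps)
  also have "\<dots> \<le> \<epsilon> * 2 ^ Suc k" using assms by simp
  finally have "3 / 2 ^ Suc k \<le> \<epsilon>" using assms by (simp add: field_simps)
  moreover have "real (Suc k) / real (Suc k * 2 ^ Suc k) = 1 / 2 ^ Suc k"
    unfolding of_nat_mult of_nat_power of_nat_numeral by (rule nonzero_divide_mult_cancel_left) simp
  ultimately have "real (Suc k) / real (Suc k * 2 ^ Suc k) + 2 / 2 ^ Suc k \<le> \<epsilon>" by simp
  then show thesis by (intro that[of "Suc k" "Suc k * 2 ^ Suc k"]) auto
qed

lemma ex_E_lower_le: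
  assumes "0 < \<epsilon>" shows "\<exists>e. E_lower (sfun (phi u)) (sfun (phi e)) \<le> ereal \<epsilon>"
proof -
  obtain k M where k: "0 < k" and M: "0 < M" and \<epsilon>: "real k / real M + 2 / 2 ^ k \<le> \<epsilon>"
    by (rule ex_block_size[OF assms])
  obtain a where a: "\<And>N. \<exists>t\<ge>N. density u k M t = a"
    using ex_eventual_max[of "density u k M" M] density_le by blast
  note [tc] = tcomp_blk[OF k]
  \<comment> \<open>Insisting on the first stage at which \<open>a\<close> parts have halted makes
    the answer unique. On a block of density \<open>a\<close> the wait ends, and only strings that
    halt later are answered wrongly.\<close>
  have "\<exists>e. \<forall>x y. phi e x = Some y \<longleftrightarrow> (\<exists>s. a * strs (blk k (len x)) \<le> M * halted u (blk k (len x)) s \<and>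
      (\<forall>s'<s. \<not> a * strs (blk k (len x)) \<le> M * halted u (blk k (len x)) s') \<and>
      y = (if halts s u x then 2 else 1))"
    by (rule ex_phi_rel) (unfold halted_def, intro tc, metis linorder_neqE_nat)
  then obtain e where e: "\<And>x y. phi e x = Some y \<longleftrightarrow>
     (\<exists>s. a * strs (blk k (len x)) \<le> M * halted u (blk k (len x)) s \<and>
      (\<forall>s'<s. \<not> a * strs (blk k (len x)) \<le> M * halted u (blk k (len x)) s') \<and>
      y = (if halts s u x then 2 else 1))" by blast
  have "err_frac (sfun (phi u)) (sfun (phi e)) (k * t - 1) \<le> \<epsilon>" if t: "1 \<le> t" "density u k M t = a" for t
  proof -
    define n where "n = k * t - 1"
    let ?W = "\<lambda>s. a * strs n \<le> M * halted u n s"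
    have ex: "\<exists>s. ?W s" using ex_halted[of u n] density_lower[of u k M t] t unfolding n_def by metis
    define s where "s = (LEAST s. ?W s)"
    have s: "?W s" "\<forall>s'<s. \<not> ?W s'" unfolding s_def using LeastI_ex[OF ex] not_less_Least by blast+
    have late: "M * card {x. x < strs n \<and> phi u x \<noteq> None \<and> \<not> halts s u x} < strs n"
      using late_halting[of u k M t a s] t s(1) unfolding n_def by simp
    have "{x. x < strs n \<and> k * (t - 1) \<le> len x \<and> nerr (phi u) (phi e) x} \<subseteq>
      {x. x < strs n \<and> phi u x \<noteq> None \<and> \<not> halts s u x}"
    proof
      fix x assume "x \<in> {x. x < strs n \<and> k * (t - 1) \<le> len x \<and> nerr (phi u) (phi e) x}"
      then have x: "x < strs n" "k * (t - 1) \<le> len x" "nerr (phi u) (phi e) x" by simp_all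
      have "len x < k * t" using x(1) k t unfolding less_strs_iff n_def by (cases "k * t") auto
      with x(2) have "blk k (len x) = n" unfolding blk_def n_def using blk_no_unique by simp
      then have "phi e x = Some (if halts s u x then 2 else 1)" unfolding e using s by auto
      with x phi_halts_iff[of u x] show "x \<in> {x. x < strs n \<and> phi u x \<noteq> None \<and> \<not> halts s u x}"
        unfolding nerr_def by (auto split: if_splits)
    qed
    then have "card {x. x < strs n \<and> k * (t - 1) \<le> len x \<and> nerr (phi u) (phi e) x} \<le>
      card {x. x < strs n \<and> phi u x \<noteq> None \<and> \<not> halts s u x}"
      by (rule card_mono[rotated]) simp
    then have "M * card {x. x < strs n \<and> k * (t - 1) \<le> len x \<and> nerr (phi u) (phi e) x} \<le>
       M * card {x. x < strs n \<and> phi u x \<noteq> None \<and> \<not> halts s u x}"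
      by (rule mult_le_mono2)
    also have "\<dots> \<le> k * strs n" using late k by (cases k) auto
    finally show ?thesis
      using block_err_frac[OF k t(1) _ M] \<epsilon> unfolding n_def by (blast intro: order_trans)
  qed
  note err = this
  have "E_lower (sfun (phi u)) (sfun (phi e)) \<le> ereal \<epsilon>"
  proof (rule E_lower_le)
    fix N
    obtain t where t: "t \<ge> Suc N" "density u k M t = a" using a by blast
    have "N \<le> k * t - 1" using t(1) k by (cases k; cases t) auto
    with err[of t] t show "\<exists>n\<ge>N. err_frac (sfun (phi u)) (sfun (phi e)) n \<le> \<epsilon>" by auto
  qed
  then show ?thesis ..
qed

lemma left_total_approx:
  assumes "left_total (sfun (phi u))" shows "approx_never_wrong (sfun (phi u))"
  unfolding approx_never_wrong_iff
proof (intro allI impI)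
  fix \<epsilon> :: real assume "0 < \<epsilon>"
  then obtain k M where k: "0 < k" and M: "0 < M" and \<epsilon>: "real k / real M + 2 / 2 ^ k \<le> \<epsilon>"
    by (rule ex_block_size)
  \<comment> \<open>From \<open>t0\<close> on the density never exceeds \<open>a\<close>, so that
    \<open>late_halting\<close> applies to every later block. Blocks before \<open>t0\<close> get no
    negative answers.\<close>
  obtain a t0 where a: "\<And>N. \<exists>t\<ge>N. density u k M t = a" and t0: "\<And>t. t0 \<le> t \<Longrightarrow> density u k M t \<le> a"
    using ex_eventual_max[of "density u k M" M] density_le by blast
  have left: "phi u y \<noteq> None" if "len y = len x" "rank y \<le> rank x" "phi u x \<noteq> None" for x y
    using assms that unfolding left_total_iff by blast
  note [tc] = tcomp_blk[OF k] tcomp_blk_no[OF k]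
  define below where "below s x = card {z. z < strs (blk k (len x)) \<and>
    (len z = len x \<and> rank z \<le> rank x \<and> \<not> halts s u z)}" for s x
  define no where "no x s \<longleftrightarrow> t0 \<le> blk_no k (len x) \<and> a * strs (blk k (len x)) \<le> M * halted u (blk k (len x)) s \<and>
    strs (blk k (len x)) \<le> M * below s x" for x s
  \<comment> \<open>If \<open>x\<close> halted, left-totality would make every string counted in
    \<open>below s x\<close> halt after stage \<open>s\<close>, but too few strings do so.\<close>
  have no: "phi u x = None" if "no x s" for x s
  proof (rule ccontr)
    assume x: "phi u x \<noteq> None"
    let ?n = "blk k (len x)"
    have "below s x \<le> card {z. z < strs ?n \<and> phi u z \<noteq> None \<and> \<not> halts s u z}"
      unfolding below_def by (rule card_mono) (use left[OF _ _ x] in auto)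
    then have "M * below s x \<le> M * card {z. z < strs ?n \<and> phi u z \<noteq> None \<and> \<not> halts s u z}"
      by (rule mult_le_mono2)
    also have "\<dots> < strs ?n"
      using that late_halting[OF t0] unfolding no_def blk_def by blast
    finally show False using that unfolding no_def by simp
  qed
  have "\<exists>e. \<forall>x y. phi e x = Some y \<longleftrightarrow> (\<exists>s. (y = 2 \<and> halts s u x) \<or> (y = 1 \<and> no x s))"
  proof (rule ex_phi_rel)
    show "decid (\<lambda>z. fst (snd z) = 2 \<and> halts (snd (snd z)) u (fst z) \<or> fst (snd z) = 1 \<and> no (fst z) (snd (snd z)))"
      unfolding no_def halted_def below_def by (intro tc)
  qed (use no phi_halts_iff in blast)
  then obtain e where e: "\<And>x y. phi e x = Some y \<longleftrightarrow> (\<exists>s. (y = 2 \<and> halts s u x) \<or> (y = 1 \<and> no x s))" by blast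
  have sound: "sound (phi u) (phi e)"
    unfolding sound_def
  proof
    fix x show "phi e x = None \<or> phi e x = Some 2 \<and> phi u x \<noteq> None \<or> phi e x = Some 1 \<and> phi u x = None"
    proof (cases "phi e x")
      case (Some y)
      then obtain s where "(y = 2 \<and> halts s u x) \<or> (y = 1 \<and> no x s)" using e by blast
      with Some no[of x] phi_halts_iff[of u x] show ?thesis by auto
    qed simp
  qed
  have "err_frac (sfun (phi u)) (sfun (phi e)) (k * t - 1) \<le> \<epsilon>"
    if t: "1 \<le> t" "t0 \<le> t" "density u k M t = a" for t
  proof -
    define n where "n = k * t - 1"
    obtain s where s: "\<And>x. x < strs n \<Longrightarrow> phi u x \<noteq> None \<Longrightarrow> halts s u x" using ex_stage by blast
    \<comment> \<open>Here the density is exactly \<open>a\<close>, so the wait succeeds by the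
      stage \<open>s\<close> at which everything up to length \<open>n\<close> has settled.\<close>
    have W: "a * strs n \<le> M * halted u n s"
    proof -
      have "{x. x < strs n \<and> phi u x \<noteq> None \<and> \<not> halts s u x} = {}" using s by blast
      then have "halting u n = halted u n s" unfolding halting_diff[of u n s] by (metis add_0_right card.empty)
      then show ?thesis using density_lower[of u k M t] t unfolding n_def by simp
    qed
    let ?E = "\<lambda>l. {x. x < strs n \<and> len x = l \<and> nerr (phi u) (phi e) x}"
    have E: "M * card (?E l) \<le> strs n" if l: "k * (t - 1) \<le> l" "l < k * t" for l
    proof (cases "?E l = {}")
      case True
      then show ?thesis by (simp only: card.empty mult_0_right le0)
    next
      case False
      \<comment> \<open>Errors are unanswered non-halting strings. All errors of length
        \<open>l\<close> are counted in \<open>below s x\<close> for the one of highest rank, so a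
        large number of them would have triggered the answer 0 on \<open>x\<close>.\<close>
      have "\<exists>x\<in>?E l. \<forall>y\<in>?E l. rank y \<le> rank x"
      proof -
        have "Max (rank ` ?E l) \<in> rank ` ?E l" using False by (intro Max_in) auto
        then obtain x where "x \<in> ?E l" "Max (rank ` ?E l) = rank x" by blast
        moreover have "rank y \<le> Max (rank ` ?E l)" if "y \<in> ?E l" for y using that by (intro Max_ge) auto
        ultimately show ?thesis by auto
      qed
      then obtain x where x: "x < strs n" "len x = l" "nerr (phi u) (phi e) x"
        and max: "\<And>y. y \<in> ?E l \<Longrightarrow> rank y \<le> rank x" by blast
      have blk: "blk_no k l = t" "blk k l = n" using blk_no_unique[OF l] by (simp_all add: blk_def n_def)
      have und: "phi u y = None \<and> phi e y = None" if "nerr (phi u) (phi e) y" for y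
      proof -
        have "phi e y = Some 2" if "phi u y \<noteq> None"
          using that e[of y 2] phi_halts_iff[of u y] by blast
        with that sound show ?thesis unfolding nerr_def sound_def by (metis option.distinct(1))
      qed
      have "?E l \<subseteq> {z. z < strs n \<and> (len z = l \<and> rank z \<le> rank x \<and> \<not> halts s u z)}"
        using max und phi_halts_iff by blast
      then have "card (?E l) \<le> below s x"
        unfolding below_def x(2) blk by (rule card_mono[rotated]) simp
      then have "M * card (?E l) \<le> M * below s x" by (rule mult_le_mono2)
      also have "\<dots> < strs n"
      proof (rule ccontr)
        assume "\<not> M * below s x < strs n"
        then have "no x s" unfolding no_def x(2) blk using W t by simp
        then have "phi e x = Some 1" using e by blast
        with und[OF x(3)] show False by simp
      qed
      finally show ?thesis by simp
    qed
    have "{x. x < strs n \<and> k * (t - 1) \<le> len x \<and> nerr (phi u) (phi e) x} \<subseteq> (\<Union>l\<in>{k * (t - 1)..<k * t}. ?E l)"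
    proof
      fix x assume "x \<in> {x. x < strs n \<and> k * (t - 1) \<le> len x \<and> nerr (phi u) (phi e) x}"
      then have x: "x < strs n" "k * (t - 1) \<le> len x" "nerr (phi u) (phi e) x" by simp_all
      have "len x < k * t" using x(1) k t unfolding less_strs_iff n_def by (cases "k * t") auto
      with x show "x \<in> (\<Union>l\<in>{k * (t - 1)..<k * t}. ?E l)" by auto
    qed
    then have "card {x. x < strs n \<and> k * (t - 1) \<le> len x \<and> nerr (phi u) (phi e) x} \<le>
        card (\<Union>l\<in>{k * (t - 1)..<k * t}. ?E l)"
      by (rule card_mono[rotated]) simp
    also have "\<dots> \<le> (\<Sum>l\<in>{k * (t - 1)..<k * t}. card (?E l))"
      by (rule card_UN_le) simp
    finally have "M * card {x. x < strs n \<and> k * (t - 1) \<le> len x \<and> nerr (phi u) (phi e) x} \<le>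
        (\<Sum>l\<in>{k * (t - 1)..<k * t}. M * card (?E l))"
      unfolding sum_distrib_left[symmetric] by (rule mult_le_mono2)
    also have "\<dots> \<le> (\<Sum>l\<in>{k * (t - 1)..<k * t}. strs n)"
      by (rule sum_mono) (use E in simp)
    also have "\<dots> = k * strs n" using t(1) by (simp flip: diff_mult_distrib2)
    finally show ?thesis
      using block_err_frac[OF k t(1) _ M] \<epsilon> unfolding n_def by (blast intro: order_trans)
  qed
  note err = this
  have "E_lower (sfun (phi u)) (sfun (phi e)) \<le> ereal \<epsilon>"
  proof (rule E_lower_le)
    fix N
    obtain t where t: "t \<ge> max t0 (Suc N)" "density u k M t = a" using a by blast
    have "N \<le> k * t - 1" using t(1) k by (cases k; cases t) auto
    with err[of t] t show "\<exists>n\<ge>N. err_frac (sfun (phi u)) (sfun (phi e)) n \<le> \<epsilon>" by auto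
  qed
  with sound show "\<exists>e. sound (phi u) (phi e) \<and> E_lower (sfun (phi u)) (sfun (phi e)) \<le> ereal \<epsilon>" by blast
qed

section \<open>Lower bounds for the error\<close>

text \<open>From an algorithm with few errors among the strings of length at most \<open>n\<close> one finds
  a stage at which nearly all of the halting strings have halted.  There are not enough remaining
  halting strings to produce a block of \<open>2 ^ l\<close> fresh values, where \<open>l = n - 2 * j\<close>; but each value of
  the block has a description of length \<open>l + j + 1\<close>.  The algorithm may depend on \<open>n\<close>, since the
  length of the description reveals \<open>n\<close>.\<close>

definition good_stage :: "nat \<Rightarrow> nat \<Rightarrow> nat \<Rightarrow> nat \<Rightarrow> nat \<Rightarrow> bool" where
  "good_stage u a n l s \<longleftrightarrow> 4 * card {x. x < strs n \<and> \<not> halts s a x} < 2 ^ l \<and>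
     4 * card {x. x < strs n \<and> runs s a x 2} < 4 * halted u n s + 2 ^ l"

definition fresh :: "nat \<Rightarrow> nat \<Rightarrow> nat \<Rightarrow> nat \<Rightarrow> nat \<Rightarrow> bool" where
  "fresh u n l s q \<longleftrightarrow> (\<forall>i<2 ^ l. \<forall>x<strs n. \<not> runs s u x (q * 2 ^ l + i))"

text \<open>At a stage where all computations have settled, an unanswered string is an error, and so
  is a positive answer on a non-halting string. The search for a good stage need not reach this
  one.\<close>

lemma good_stage_ex:
  assumes "4 * card {x. x < strs n \<and> nerr (phi u) (phi a) x} < 2 ^ l"
  shows "\<exists>s. good_stage u a n l s"
proof -
  let ?E = "{x. x < strs n \<and> nerr (phi u) (phi a) x}"
  obtain s1 s2 where s: "\<And>x. x < strs n \<Longrightarrow> phi a x \<noteq> None \<Longrightarrow> halts s1 a x"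
    "\<And>x. x < strs n \<Longrightarrow> phi u x \<noteq> None \<Longrightarrow> halts s2 u x"
    using ex_stage[of "strs n" a] ex_stage[of "strs n" u] by blast
  define s where "s = max s1 s2"
  have a: "halts s a x" if "x < strs n" "phi a x \<noteq> None" for x
    using s(1)[OF that] by (rule halts_mono) (simp add: s_def)
  have u: "halts s u x" if "x < strs n" "phi u x \<noteq> None" for x
    using s(2)[OF that] by (rule halts_mono) (simp add: s_def)
  have "card {x. x < strs n \<and> \<not> halts s a x} \<le> card ?E"
  proof (rule card_mono)
    show "{x. x < strs n \<and> \<not> halts s a x} \<subseteq> ?E"
    proof
      fix x assume x: "x \<in> {x. x < strs n \<and> \<not> halts s a x}"
      with a have "phi a x = None" by blast
      with x show "x \<in> ?E" unfolding nerr_def by auto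
    qed
  qed simp
  moreover have "card {x. x < strs n \<and> runs s a x 2} \<le> card ({x. x < strs n \<and> halts s u x} \<union> ?E)"
  proof (rule card_mono)
    show "{x. x < strs n \<and> runs s a x 2} \<subseteq> {x. x < strs n \<and> halts s u x} \<union> ?E"
    proof
      fix x assume x: "x \<in> {x. x < strs n \<and> runs s a x 2}"
      then have "phi a x = Some 2" using runs_phi by blast
      with x u[of x] show "x \<in> {x. x < strs n \<and> halts s u x} \<union> ?E" unfolding nerr_def by auto
    qed
  qed simp
  moreover have "card ({x. x < strs n \<and> halts s u x} \<union> ?E) \<le> halted u n s + card ?E"
    unfolding halted_def by (rule card_Un_le)
  ultimately have "good_stage u a n l s" using assms unfolding good_stage_def by linarith
  then show ?thesis ..
qed

lemma fresh_ex: "\<exists>q. fresh u n l s q"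
proof -
  \<comment> \<open>For undefined \<open>phi u x\<close> this contains the arbitrary value
    \<open>the None\<close>, which can only raise the maximum.\<close>
  let ?Y = "(\<lambda>x. the (phi u x)) ` {..<strs n}"
  have "fresh u n l s (Suc (Max ?Y))"
    unfolding fresh_def
  proof (intro allI impI notI)
    fix i x assume "x < strs n" "runs s u x (Suc (Max ?Y) * 2 ^ l + i)"
    then have "Suc (Max ?Y) * 2 ^ l + i \<in> ?Y" using runs_phi[of s u x] by force
    then have "Suc (Max ?Y) * 2 ^ l + i \<le> Max ?Y" by (intro Max_ge) auto
    moreover have "Suc (Max ?Y) * 1 + 0 \<le> Suc (Max ?Y) * 2 ^ l + i"
      by (intro add_le_mono mult_le_mono2) simp_all
    ultimately have "Suc (Max ?Y) * 1 + 0 \<le> Max ?Y" by (rule order_trans[rotated])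
    then show False by simp
  qed
  then show ?thesis ..
qed

text \<open>A halting string is answered positively by stage \<open>s\<close>, or unanswered by
  then, or an error. The first kind exceeds \<open>halted u n s\<close> by less than a quarter of
  \<open>2 ^ l\<close>, and the other two kinds stay below a quarter each; this is the origin of the
  factor 4.\<close>

lemma late_halting_card:
  assumes "good_stage u a n l s" "4 * card {x. x < strs n \<and> nerr (phi u) (phi a) x} < 2 ^ l"
  shows "card {x. x < strs n \<and> phi u x \<noteq> None \<and> \<not> halts s u x} < 2 ^ l"
proof -
  let ?E = "{x. x < strs n \<and> nerr (phi u) (phi a) x}"
  let ?N = "{x. x < strs n \<and> \<not> halts s a x}" and ?Y = "{x. x < strs n \<and> runs s a x 2}"
  have "{x. x < strs n \<and> phi u x \<noteq> None} \<subseteq> ?Y \<union> (?N \<union> ?E)"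
  proof
    fix x assume x: "x \<in> {x. x < strs n \<and> phi u x \<noteq> None}"
    show "x \<in> ?Y \<union> (?N \<union> ?E)"
    proof (cases "halts s a x")
      case True
      then obtain y where y: "runs s a x y" unfolding halts_runs_iff by blast
      then have "phi a x = Some y" by (rule runs_phi)
      with x y show ?thesis unfolding nerr_def by auto
    qed (use x in simp)
  qed
  then have "halting u n \<le> card (?Y \<union> (?N \<union> ?E))"
    unfolding halting_def by (rule card_mono[rotated]) simp
  also have "\<dots> \<le> card ?Y + (card ?N + card ?E)"
    by (rule order_trans[OF card_Un_le add_left_mono[OF card_Un_le]])
  finally show ?thesis
    using assms unfolding good_stage_def halting_diff[of u n s] by linarith
qed

text \<open>With fewer errors, each of \<open>2 ^ l\<close> fresh values would need its own late
  halting string of length at most \<open>n\<close>, but there are fewer than \<open>2 ^ l\<close>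
  of those.\<close>

lemma error_lower_bound:
  assumes opt: "optimal (sfun (phi u))" and g: "tcomp g"
  shows "\<exists>j. \<forall>n\<ge>2 * j. 2 ^ (n - 2 * j) \<le> 4 * card {x. x < strs n \<and> nerr (phi u) (phi (g n)) x}"
proof -
  define P where "P j l w \<longleftrightarrow> good_stage u (g (l + 2 * j)) (l + 2 * j) l (pfst w) \<and>
    fresh u (l + 2 * j) l (pfst w) (psnd w)" for j l w
  have [tc]: "tcomp f \<Longrightarrow> tcomp (\<lambda>z. g (f z))" for f :: "'z::enc \<Rightarrow> nat"
    by (rule tcomp_comp[OF g])
  \<comment> \<open>The least \<open>w\<close> gives all \<open>p\<close> of one length the same
    stage and the same block; \<open>p + 1 - 2 ^ l\<close> is the position of \<open>p\<close> among
    the strings of length \<open>l\<close>.\<close>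
  have "\<exists>v. \<forall>x y. phi v x = Some y \<longleftrightarrow> (\<exists>t. x = pad (fst t) (fst (snd t)) \<and>
     (P (fst t) (len (fst (snd t))) (snd (snd t)) \<and> (\<forall>w<snd (snd t). \<not> P (fst t) (len (fst (snd t))) w)) \<and>
     y = psnd (snd (snd t)) * 2 ^ len (fst (snd t)) + (fst (snd t) + 1 - 2 ^ len (fst (snd t))))"
  proof (rule ex_phi_rel)
    fix x y y' and t t' :: "nat \<times> nat \<times> nat"
    assume *: "x = pad (fst t) (fst (snd t)) \<and>
     (P (fst t) (len (fst (snd t))) (snd (snd t)) \<and> (\<forall>w<snd (snd t). \<not> P (fst t) (len (fst (snd t))) w)) \<and>
     y = psnd (snd (snd t)) * 2 ^ len (fst (snd t)) + (fst (snd t) + 1 - 2 ^ len (fst (snd t)))"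
     "x = pad (fst t') (fst (snd t')) \<and>
     (P (fst t') (len (fst (snd t'))) (snd (snd t')) \<and> (\<forall>w<snd (snd t'). \<not> P (fst t') (len (fst (snd t'))) w)) \<and>
     y' = psnd (snd (snd t')) * 2 ^ len (fst (snd t')) + (fst (snd t') + 1 - 2 ^ len (fst (snd t')))"
    then have 1: "fst t = fst t'" "fst (snd t) = fst (snd t')" by simp_all
    with * have "snd (snd t) = snd (snd t')" by (metis linorder_neqE_nat)
    with * 1 show "y = y'" by simp
  qed (unfold P_def good_stage_def fresh_def halted_def, intro tc)
  then obtain v where v: "\<And>x y. phi v x = Some y \<longleftrightarrow> (\<exists>t. x = pad (fst t) (fst (snd t)) \<and>
     (P (fst t) (len (fst (snd t))) (snd (snd t)) \<and> (\<forall>w<snd (snd t). \<not> P (fst t) (len (fst (snd t))) w)) \<and>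
     y = psnd (snd (snd t)) * 2 ^ len (fst (snd t)) + (fst (snd t) + 1 - 2 ^ len (fst (snd t))))"
    by blast
  obtain c where c: "\<And>p y. phi v p = Some y \<Longrightarrow> \<exists>q. len q \<le> len p + c \<and> phi u q = Some y"
    using opt unfolding optimal_iff by blast
  \<comment> \<open>A description of length \<open>l + j + 1\<close> becomes a program of length at
    most \<open>l + j + 1 + c\<close>, which is \<open>l + 2 * j = n\<close>. As \<open>c\<close>
    depends on the machine \<open>v\<close>, that machine had to handle every
    \<open>j\<close>.\<close>
  define j where "j = c + 1"
  have "2 ^ (n - 2 * j) \<le> 4 * card {x. x < strs n \<and> nerr (phi u) (phi (g n)) x}" if n: "2 * j \<le> n" for n
  proof (rule ccontr)
    assume "\<not> 2 ^ (n - 2 * j) \<le> 4 * card {x. x < strs n \<and> nerr (phi u) (phi (g n)) x}"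
    moreover define l where "l = n - 2 * j"
    ultimately have E: "4 * card {x. x < strs n \<and> nerr (phi u) (phi (g n)) x} < 2 ^ l" by simp
    have n_eq: "n = l + 2 * j" using n by (simp add: l_def)
    obtain s' where "good_stage u (g n) n l s'" using good_stage_ex[OF E] by blast
    moreover obtain q' where "fresh u n l s' q'" using fresh_ex by blast
    ultimately have "P j l (prod_encode (s', q'))" unfolding P_def n_eq by simp
    then have ex: "\<exists>w. P j l w" by blast
    define w where "w = (LEAST w. P j l w)"
    have w: "P j l w" "\<forall>w'<w. \<not> P j l w'" unfolding w_def using LeastI_ex[OF ex] not_less_Least by blast+
    let ?L = "{x. x < strs n \<and> phi u x \<noteq> None \<and> \<not> halts (pfst w) u x}"
    have "\<exists>z\<in>?L. phi u z = Some (psnd w * 2 ^ l + i)" if i: "i < 2 ^ l" for i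
    proof -
      have "len (2 ^ l - 1 + i) = l" unfolding len_eq_iff atLeastLessThan_iff using i by linarith
      moreover have "2 ^ l - 1 + i + 1 - 2 ^ l = i" by simp
      ultimately have "phi v (pad j (2 ^ l - 1 + i)) = Some (psnd w * 2 ^ l + i)"
        unfolding v using w by (intro exI[of _ "(j, 2 ^ l - 1 + i, w)"]) simp
      then obtain z where z: "len z \<le> len (pad j (2 ^ l - 1 + i)) + c" "phi u z = Some (psnd w * 2 ^ l + i)"
        using c by blast
      have "len z \<le> n" using z(1) \<open>len (2 ^ l - 1 + i) = l\<close> unfolding len_pad by (simp add: n_eq j_def)
      then have "z < strs n" by (simp add: less_strs_iff)
      moreover have "\<not> halts (pfst w) u z"
      proof
        assume "halts (pfst w) u z"
        then obtain y where y: "runs (pfst w) u z y" unfolding halts_runs_iff by blast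
        then have "y = psnd w * 2 ^ l + i" using runs_phi[OF y] z(2) by simp
        moreover have "fresh u n l (pfst w) (psnd w)" using w(1) unfolding P_def n_eq by simp
        ultimately show False using y i \<open>z < strs n\<close> unfolding fresh_def by simp
      qed
      ultimately show ?thesis using z(2) by blast
    qed
    then have "\<forall>i\<in>{..<2 ^ l}. \<exists>z. z \<in> ?L \<and> phi u z = Some (psnd w * 2 ^ l + i)" by auto
    from bchoice[OF this] obtain Z where Z: "\<And>i. i < 2 ^ l \<Longrightarrow> Z i \<in> ?L"
      "\<And>i. i < 2 ^ l \<Longrightarrow> phi u (Z i) = Some (psnd w * 2 ^ l + i)" by auto
    have "card {..<2 ^ l :: nat} \<le> card ?L"
    proof (rule card_inj_on_le)
      show "inj_on Z {..<2 ^ l}"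
      proof (rule inj_onI)
        fix i i' assume i: "i \<in> {..<2 ^ l}" "i' \<in> {..<2 ^ l}" and eq: "Z i = Z i'"
        have "Some (psnd w * 2 ^ l + i) = Some (psnd w * 2 ^ l + i')"
          unfolding Z(2)[OF i(1)[unfolded lessThan_iff], symmetric] Z(2)[OF i(2)[unfolded lessThan_iff], symmetric]
            eq ..
        then show "i = i'" by simp
      qed
      show "Z ` {..<2 ^ l} \<subseteq> ?L" using Z(1) by blast
    qed simp
    moreover have "card ?L < 2 ^ l"
      using w(1) by (intro late_halting_card[OF _ E]) (simp add: P_def n_eq)
    ultimately show False by simp
  qed
  then show ?thesis by blast
qed

lemma err_frac_lower_bound:
  assumes "optimal (sfun (phi u))" "tcomp g"
  shows "\<exists>\<epsilon>>0. \<exists>N. \<forall>n\<ge>N. \<epsilon> \<le> err_frac (sfun (phi u)) (sfun (phi (g n))) n"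
proof -
  obtain j where j: "\<And>n. 2 * j \<le> n \<Longrightarrow>
      2 ^ (n - 2 * j) \<le> 4 * card {x. x < strs n \<and> nerr (phi u) (phi (g n)) x}"
    using error_lower_bound[OF assms] by blast
  \<comment> \<open>At least \<open>2 ^ (n - 2 * j) / 4\<close> errors among at most
    \<open>2 ^ (n + 1)\<close> strings.\<close>
  define \<epsilon> :: real where "\<epsilon> = 1 / (8 * 2 ^ (2 * j))"
  have "\<epsilon> \<le> err_frac (sfun (phi u)) (sfun (phi (g n))) n" if n: "2 * j \<le> n" for n
  proof -
    let ?c = "card {x. x < strs n \<and> nerr (phi u) (phi (g n)) x}"
    have "real (2 ^ (n - 2 * j)) \<le> real (4 * ?c)" using j[OF n] by (rule of_nat_mono)
    then have c: "2 ^ (n - 2 * j) \<le> 4 * real ?c" by simp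
    have "real (strs n) \<le> real (2 ^ Suc n)" using strs_le by (rule of_nat_mono)
    also have "\<dots> = 2 * 2 ^ (2 * j) * 2 ^ (n - 2 * j)"
      using n by (simp flip: power_add)
    finally have "\<epsilon> * real (strs n) \<le> \<epsilon> * (2 * 2 ^ (2 * j) * 2 ^ (n - 2 * j))"
      by (rule mult_left_mono) (simp add: \<epsilon>_def)
    also have "\<dots> = 2 ^ (n - 2 * j) / 4" by (simp add: \<epsilon>_def)
    also have "\<dots> \<le> real ?c" using c by simp
    finally show ?thesis unfolding err_frac_eq by (simp add: pos_le_divide_eq)
  qed
  moreover have "0 < \<epsilon>" by (simp add: \<epsilon>_def)
  ultimately show ?thesis by blast
qed

lemma E_lower_pos:
  assumes "optimal (sfun (phi u))" shows "0 < E_lower (sfun (phi u)) (sfun (phi e))"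
proof -
  obtain \<epsilon> N where "0 < \<epsilon>" "\<And>n. N \<le> n \<Longrightarrow> \<epsilon> \<le> err_frac (sfun (phi u)) (sfun (phi e)) n"
    using err_frac_lower_bound[OF assms tcomp_const[of e]] by blast
  then have "0 < ereal \<epsilon>" "ereal \<epsilon> \<le> E_lower (sfun (phi u)) (sfun (phi e))"
    by (auto intro: E_lower_ge)
  then show ?thesis by (rule less_le_trans)
qed

lemma E_upper_ge:
  assumes "\<And>N. \<exists>n\<ge>N. \<epsilon> \<le> err_frac U A n" shows "ereal \<epsilon> \<le> E_upper U A"
proof (rule ccontr)
  assume "\<not> ereal \<epsilon> \<le> E_upper U A"
  then have "limsup (\<lambda>n. ereal (err_frac U A n)) < ereal \<epsilon>" by (simp add: E_upper_def)
  from Limsup_lessD[OF this] obtain N where "\<And>n. N \<le> n \<Longrightarrow> err_frac U A n < \<epsilon>"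
    by (auto simp: eventually_sequentially)
  with assms[of N] show False by (meson not_le)
qed

text \<open>Every algorithm is \<open>phi (pfst n)\<close> for infinitely many \<open>n\<close>, which makes the bound uniform.\<close>

lemma E_upper_uniform:
  assumes "optimal (sfun (phi u))"
  shows "\<exists>\<epsilon>>0. \<forall>e. ereal \<epsilon> \<le> E_upper (sfun (phi u)) (sfun (phi e))"
proof -
  have "tcomp (\<lambda>n. pfst n)" by (intro tc)
  from err_frac_lower_bound[OF assms this] obtain \<epsilon> N where \<epsilon>: "0 < \<epsilon>"
    and N: "\<And>n. N \<le> n \<Longrightarrow> \<epsilon> \<le> err_frac (sfun (phi u)) (sfun (phi (pfst n))) n" by blast
  have "ereal \<epsilon> \<le> E_upper (sfun (phi u)) (sfun (phi e))" for e
  proof (rule E_upper_ge)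
    fix N'
    have "max N N' \<le> prod_encode (e, max N N')" by (rule le_prod_encode_2)
    with N[of "prod_encode (e, max N N')"]
    show "\<exists>n\<ge>N'. \<epsilon> \<le> err_frac (sfun (phi u)) (sfun (phi e)) n"
      by (intro exI[of _ "prod_encode (e, max N N')"]) simp
  qed
  with \<epsilon> show ?thesis by blast
qed

theorem theorem3p1:
  fixes U :: "bstr \<Rightarrow> bstr option"
  assumes "computable U" and "optimal U"
  shows "(\<forall>A. computable A \<longrightarrow> E_lower U A > 0)
       \<and> (\<exists>\<epsilon>::real>0. \<forall>A. computable A \<longrightarrow> E_upper U A \<ge> ereal \<epsilon>)
       \<and> (\<forall>\<epsilon>::real>0. \<exists>A. computable A \<and> E_lower U A \<le> ereal \<epsilon>)
       \<and> ((\<exists>U'. computable U' \<and> optimal U' \<and> approx_never_wrong U')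
          \<and> (\<exists>U'. computable U' \<and> optimal U' \<and> \<not> approx_never_wrong U')
          \<and> (\<forall>U'. computable U' \<and> optimal U' \<and> left_total U' \<longrightarrow> approx_never_wrong U')
          \<and> (\<forall>U'. computable U' \<and> effectively_optimal U' \<longrightarrow> \<not> approx_never_wrong U'))"
proof -
  obtain u where U: "U = sfun (phi u)" using assms(1) unfolding computable_iff by blast
  have opt: "optimal (sfun (phi u))" using assms(2) U by simp
  show ?thesis
  proof (intro conjI)
    show "\<forall>A. computable A \<longrightarrow> E_lower U A > 0"
      unfolding all_computable_iff U using E_lower_pos[OF opt] by blast
    show "\<exists>\<epsilon>::real>0. \<forall>A. computable A \<longrightarrow> E_upper U A \<ge> ereal \<epsilon>"
      unfolding all_computable_iff U by (rule E_upper_uniform[OF opt])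
    show "\<forall>\<epsilon>::real>0. \<exists>A. computable A \<and> E_lower U A \<le> ereal \<epsilon>"
      unfolding U using ex_E_lower_le computable_phi by blast
    show "\<exists>U'. computable U' \<and> optimal U' \<and> approx_never_wrong U'"
      using ex_left_total_optimal[OF opt] left_total_approx computable_phi by blast
    show "\<exists>U'. computable U' \<and> optimal U' \<and> \<not> approx_never_wrong U'"
      using ex_effectively_optimal effectively_optimal_imp_optimal effectively_optimal_not_approx
        computable_phi by blast
    show "\<forall>U'. computable U' \<and> optimal U' \<and> left_total U' \<longrightarrow> approx_never_wrong U'"
      using left_total_approx by (auto simp: computable_iff)
    show "\<forall>U'. computable U' \<and> effectively_optimal U' \<longrightarrow> \<not> approx_never_wrong U'"
      using effectively_optimal_not_approx by (auto simp: computable_iff)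
  qed
qed

end
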